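(* Let $k\ge1$, $d\in\{2,3\}$, and consider a family of simplicial triangulations $\mathcal{T}$ of $\Omega\subset\mathbb{R}^d$, indexed by the mesh size $h$, with the spaces, forms, norms and matrices $A,B,C,Q,M$ defined in the context, for which the $h$-uniform stability, boundedness and inf-sup properties listed in the context hold. Let $$\mathbb{A}=\begin{bmatrix} A & B^T & C^T \\ B & 0 & 0 \\ C & 0 & 0 \end{bmatrix},\qquad \mathbb{P}=\mathrm{bdiag}(\tilde A,Q,M)=\begin{bmatrix} \tilde A & 0 & 0 \\ 0 & Q & 0 \\ 0 & 0 & M \end{bmatrix},$$ where $\tilde A$ is an operator that is spectrally equivalent to $A$. Then there exist positive constants $c_1,c_2,c_3,c_4$, independent of $h$, such that the eigenvalues $\rho$ of $\mathbb{P}^{-1}\mathbb{A}$ satisfy $$\rho\in[-c_1,-c_2]\cup[c_3,c_4].$$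
   Context: Mesh. $\mathcal{T}$ is a triangulation of $\Omega$ into simplices $K$; $\mathcal{F}_I$ and $\mathcal{F}_B$ are the sets of interior and boundary facets, $\mathcal{F}=\mathcal{F}_I\cup\mathcal{F}_B$; $h_F$ denotes the size of facet $F$; $\boldsymbol{n}$ is the outward unit normal on $\partial K$. On an interior facet shared by $K^+$ and $K^-$, superscripts $\pm$ denote traces from $K^\pm$, $\boldsymbol{n}^+=-\boldsymbol{n}^-$, the average is $\{\!\!\{q\}\!\!\}=\frac12(q^++q^-)$, and the jumps are $[\![\boldsymbol{v}]\!]=\boldsymbol{v}^+-\boldsymbol{v}^-$, $[\![\boldsymbol{v}\cdot\boldsymbol{n}]\!]=\boldsymbol{v}^+\cdot\boldsymbol{n}^++\boldsymbol{v}^-\cdot\boldsymbol{n}^-$, $[\![\boldsymbol{v}\otimes\boldsymbol{n}]\!]=\boldsymbol{v}^+\otimes\boldsymbol{n}^++\boldsymbol{v}^-\otimes\boldsymbol{n}^-$. On boundary facets, $\{\!\!\{q\}\!\!\}=q$, $[\![\boldsymbol{v}]\!]=\boldsymbol{v}$, $[\![\boldsymbol{v}\cdot\boldsymbol{n}]\!]=\boldsymbol{v}\cdot\boldsymbol{n}$, $[\![\boldsymbol{v}\otimes\boldsymbol{n}]\!]=\boldsymbol{v}\otimes\boldsymbol{n}$ and $\boldsymbol{n}^+=\boldsymbol{n}$. Spaces. $P_k(D)$ denotes polynomials of degree at most $k$ on $D$. $\boldsymbol{V}_h^k=\{\boldsymbol{v}_h\in L^2(\Omega)^d: \boldsymbol{v}_h|_K\in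 P_k(K)^d\ \forall K\in\mathcal{T}\}$; $Q_h^{k-1}=\{q_h\in L^2(\Omega): q_h|_K\in P_{k-1}(K)\ \forall K\in\mathcal{T},\ \int_\Omega q_h\,dx=0\}$; $M_h^k=\{\xi_h\in L^2(\mathcal{F}):\xi_h|_F\in P_k(F)\ \forall F\in\mathcal{F}\}$. Norms. $\|\cdot\|$ is the $L^2(\Omega)$ norm, $\|\cdot\|_K$ and $\|\cdot\|_F$ are the $L^2$ norms on $K$ and $F$, $\|\boldsymbol{v}\|_{1,h}^2=\sum_{K\in\mathcal{T}}\|\nabla\boldsymbol{v}\|_K^2+\sum_{F\in\mathcal{F}}\int_F h_F^{-1}|[\![\boldsymbol{v}\otimes\boldsymbol{n}]\!]|^2\,ds$, and $\|\xi\|_\lambda=\big(\sum_{F\in\mathcal{F}}h_F\|\xi\|_F^2\big)^{1/2}$. Forms. With penalty parameter $\eta>0$ (sufficiently large), $$a_h(\boldsymbol{u},\boldsymbol{v})=\sum_{K}\int_K\nabla\boldsymbol{u}:\nabla\boldsymbol{v}\,dx+\sum_{F\in\mathcal{F}}\int_F\frac{\eta}{h_F}[\![\boldsymbol{u}]\!]\cdot[\![\boldsymbol{v}]\!]\,ds-\sum_{F\in\mathcal{F}}\int_F[\![\boldsymbol{u}]\!]\otimes\boldsymbol{n}^+:\{\!\!\{\nabla\boldsymbol{v}\}\!\!\}\,ds-\sum_{F\in\mathcal{F}}\int_F[\![\boldsymbol{v}]\!]\otimes\boldsymbol{n}^+:\{\!\!\{\nabla\boldsymbol{u}\}\!\!\}\,ds,$$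 $$b_h((p,\lambda),\boldsymbol{v})=-\sum_K\int_K p\,\nabla\cdot\boldsymbol{v}\,dx+\sum_{F\in\mathcal{F}}\int_F[\![\boldsymbol{v}\cdot\boldsymbol{n}]\!]\,\lambda\,ds.$$ Standing properties. There are positive constants $\alpha,c_a,c_b,\beta,\beta_\lambda,c_i$, independent of $h$, such that for all $\boldsymbol{u}_h,\boldsymbol{v}_h\in\boldsymbol{V}_h^k$, $q_h\in Q_h^{k-1}$, $\xi_h\in M_h^k$: $a_h(\boldsymbol{v}_h,\boldsymbol{v}_h)\ge\alpha\|\boldsymbol{v}_h\|_{1,h}^2$; $|a_h(\boldsymbol{u}_h,\boldsymbol{v}_h)|\le c_a\|\boldsymbol{u}_h\|_{1,h}\|\boldsymbol{v}_h\|_{1,h}$; $|b_h((q_h,\xi_h),\boldsymbol{v}_h)|\le c_b\|\boldsymbol{v}_h\|_{1,h}(\|q_h\|^2+\|\xi_h\|_\lambda^2)^{1/2}$; and $$c_i\big(\beta^2\|q_h\|^2+\beta_\lambda^2\|\xi_h\|_\lambda^2\big)^{1/2}\le\sup_{0\ne\boldsymbol{w}_h\in\boldsymbol{V}_h^k}\frac{b_h((q_h,\xi_h),\boldsymbol{w}_h)}{\|\boldsymbol{w}_h\|_{1,h}}.$$ Matrices. Fix bases of $\boldsymbol{V}_h^k,Q_h^{k-1},M_h^k$, of dimensions $n_u,n_p,n_l$, and let $v\in\mathbb{R}^{n_u}$, $q\in\mathbb{R}^{n_p}$, $\xi\in\mathbb{R}^{n_l}$ be the coefficient vectors of $\boldsymbol{v}_h,q_h,\xi_h$.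 $A$ (symmetric), $B$, $C$, $Q$ (symmetric), $M$ (symmetric) are the matrices with $a_h(\boldsymbol{v}_h,\boldsymbol{v}_h)=v^TAv$, $b_h((q_h,0),\boldsymbol{v}_h)=q^TBv$, $b_h((0,\xi_h),\boldsymbol{v}_h)=\xi^TCv$, $\|q_h\|^2=q^TQq$, $\|\xi_h\|_\lambda^2=\xi^TM\xi$. Spectral equivalence of $\tilde A$ to $A$ means: $\tilde A$ is symmetric positive definite and there are positive constants $\delta,\Delta$, independent of $h$, with $\delta\, v^T\tilde Av\le v^TAv\le\Delta\, v^T\tilde Av$ for all $v\in\mathbb{R}^{n_u}$. *)

theory Defs
  imports "HOL-Analysis.Analysis" "Jordan_Normal_Form.Spectral_Radius"
begin

(* Matrix.vec and Finite_Cartesian_Product.vec both claim these symbols; here they denote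
   the Euclidean versions, and the matrix-library operations are written by name. *)
no_notation vec_index (infixl "$" 100)
no_notation scalar_prod (infix "\<bullet>" 70)

section \<open>Simplicial meshes\<close>

text \<open>Besides \<^const>\<open>triangulation\<close> (finiteness and conformity), all elements are full-dimensional
  closed simplices.  The last conjunct rules out open sets that are dense in the meshed region
  without filling it up to a null set.\<close>

definition simplicial_mesh :: "(real^'d) set \<Rightarrow> (real^'d) set set \<Rightarrow> bool" where
  "simplicial_mesh \<Omega> T \<longleftrightarrow>
     open \<Omega> \<and> \<Omega> \<noteq> {} \<and> triangulation T \<and> (\<forall>K\<in>T. int CARD('d) simplex K) \<and>
     \<Union>T = closure \<Omega> \<and> (\<forall>K\<in>T. interior K \<subseteq> \<Omega>)"

definition mesh_size :: "(real^'d) set set \<Rightarrow> real" where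
  "mesh_size T = Max (diameter ` T)"

definition facets :: "(real^'d) set set \<Rightarrow> (real^'d) set set" where
  "facets T = {F. \<exists>K\<in>T. F facet_of K}"

definition interior_facets :: "(real^'d) set set \<Rightarrow> (real^'d) set set" where
  "interior_facets T = {F. \<exists>K\<in>T. \<exists>K'\<in>T. K \<noteq> K' \<and> F facet_of K \<and> F facet_of K'}"

definition facet_size :: "(real^'d) set \<Rightarrow> real" where
  "facet_size F = diameter F"

text \<open>A choice, for every facet \<open>F\<close>, of the element \<open>P F\<close> playing the role of \<open>K\<^sup>+\<close>;
  on a boundary facet the only element containing it is forced.\<close>

definition plus_choice :: "(real^'d) set set \<Rightarrow> ((real^'d) set \<Rightarrow> (real^'d) set) \<Rightarrow> bool" where
  "plus_choice T P \<longleftrightarrow> (\<forall>F\<in>facets T. P F \<in> T \<and> F facet_of P F)"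

definition minus_elem ::
    "(real^'d) set set \<Rightarrow> ((real^'d) set \<Rightarrow> (real^'d) set) \<Rightarrow> (real^'d) set \<Rightarrow> (real^'d) set" where
  "minus_elem T P F = (THE K. K \<in> T \<and> F facet_of K \<and> K \<noteq> P F)"

text \<open>Taking both points in \<open>F\<close> shows that such a vector is orthogonal to \<open>F\<close>.\<close>

definition outward_normal :: "(real^'d) set \<Rightarrow> (real^'d) set \<Rightarrow> real^'d" where
  "outward_normal K F = (THE n. norm n = 1 \<and> (\<forall>x\<in>F. \<forall>y\<in>K. n \<bullet> (y - x) \<le> 0))"

text \<open>Surface measure on a flat facet: Lebesgue measure on the prism of height one with
  mid-section \<open>F\<close>, pushed forward by the orthogonal projection onto the hyperplane of \<open>F\<close>.\<close>

definition facet_measure :: "(real^'d) set \<Rightarrow> (real^'d) measure" where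
  "facet_measure F =
     (let proj = closest_point (affine hull F)
      in distr (restrict_space lborel {y. proj y \<in> F \<and> dist y (proj y) \<le> 1/2}) borel proj)"

text \<open>Integrals over elements and facets are taken over the (relative) interiors; the
  remaining parts are null sets.\<close>

definition elem_int :: "(real^'d) set \<Rightarrow> (real^'d \<Rightarrow> real) \<Rightarrow> real" where
  "elem_int K g = (LINT x:interior K|lborel. g x)"

definition facet_int :: "(real^'d) set \<Rightarrow> (real^'d \<Rightarrow> real) \<Rightarrow> real" where
  "facet_int F g = (LINT x:rel_interior F|facet_measure F. g x)"

section \<open>Discrete spaces\<close>

definition Pk :: "nat \<Rightarrow> (real^'d) set \<Rightarrow> (real^'d \<Rightarrow> real) set" where
  "Pk k D = {f. \<exists>c :: ('d \<Rightarrow> nat) \<Rightarrow> real. \<forall>x\<in>D.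
      f x = (\<Sum>\<alpha> | sum \<alpha> UNIV \<le> k. c \<alpha> * (\<Prod>i\<in>UNIV. (x $ i) ^ \<alpha> i))}"

text \<open>The elements of the broken spaces are \<open>L\<^sup>2\<close> classes.  Each class is represented by its
  unique member that is polynomial on every open element (relatively open facet) and vanishes
  elsewhere, so that equality of functions is equality of classes.  Square integrability is
  automatic, the mesh being finite and bounded.\<close>

definition V_space :: "(real^'d) set set \<Rightarrow> nat \<Rightarrow> (real^'d \<Rightarrow> real^'d) set" where
  "V_space T k = {v. (\<forall>K\<in>T. \<forall>i. (\<lambda>x. v x $ i) \<in> Pk k (interior K)) \<and>
                     (\<forall>x. x \<notin> (\<Union>K\<in>T. interior K) \<longrightarrow> v x = 0)}"

definition Q_space :: "(real^'d) set \<Rightarrow> (real^'d) set set \<Rightarrow> nat \<Rightarrow> (real^'d \<Rightarrow> real) set" where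
  "Q_space \<Omega> T m = {q. (\<forall>K\<in>T. q \<in> Pk m (interior K)) \<and>
                       (\<forall>x. x \<notin> (\<Union>K\<in>T. interior K) \<longrightarrow> q x = 0) \<and>
                       (LINT x:\<Omega>|lborel. q x) = 0}"

definition M_space :: "(real^'d) set set \<Rightarrow> nat \<Rightarrow> (real^'d \<Rightarrow> real) set" where
  "M_space T k = {\<xi>. (\<forall>F\<in>facets T. \<xi> \<in> Pk k (rel_interior F)) \<and>
                     (\<forall>x. x \<notin> (\<Union>F\<in>facets T. rel_interior F) \<longrightarrow> \<xi> x = 0)}"

section \<open>Traces, jumps and averages\<close>

definition trace_from :: "(real^'d) set \<Rightarrow> (real^'d \<Rightarrow> 'b::t2_space) \<Rightarrow> real^'d \<Rightarrow> 'b" where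
  "trace_from K f x = Lim (at x within interior K) f"

definition tensor :: "real^'d \<Rightarrow> real^'d \<Rightarrow> real^'d^'d" where
  "tensor u w = (\<chi> i j. u $ i * w $ j)"

text \<open>\<open>(grad v x) $ i $ j\<close> is the partial derivative of the \<open>i\<close>-th component in direction \<open>j\<close>.
  The inner product and norm of \<open>real^'d^'d\<close> are the Frobenius ones.\<close>

definition grad :: "(real^'d \<Rightarrow> real^'d) \<Rightarrow> real^'d \<Rightarrow> real^'d^'d" where
  "grad v x = matrix (frechet_derivative v (at x))"

definition divergence :: "(real^'d \<Rightarrow> real^'d) \<Rightarrow> real^'d \<Rightarrow> real" where
  "divergence v x = (\<Sum>i\<in>UNIV. grad v x $ i $ i)"

context
  fixes T :: "(real^'d) set set" and P :: "(real^'d) set \<Rightarrow> (real^'d) set"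
begin

definition n_plus :: "(real^'d) set \<Rightarrow> real^'d" where
  "n_plus F = outward_normal (P F) F"

definition n_minus :: "(real^'d) set \<Rightarrow> real^'d" where
  "n_minus F = outward_normal (minus_elem T P F) F"

definition jump :: "(real^'d) set \<Rightarrow> (real^'d \<Rightarrow> real^'d) \<Rightarrow> real^'d \<Rightarrow> real^'d" where
  "jump F v x =
     (if F \<in> interior_facets T
      then trace_from (P F) v x - trace_from (minus_elem T P F) v x
      else trace_from (P F) v x)"

definition jump_normal :: "(real^'d) set \<Rightarrow> (real^'d \<Rightarrow> real^'d) \<Rightarrow> real^'d \<Rightarrow> real" where
  "jump_normal F v x =
     (if F \<in> interior_facets T
      then trace_from (P F) v x \<bullet> n_plus F + trace_from (minus_elem T P F) v x \<bullet> n_minus F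
      else trace_from (P F) v x \<bullet> n_plus F)"

definition jump_tensor :: "(real^'d) set \<Rightarrow> (real^'d \<Rightarrow> real^'d) \<Rightarrow> real^'d \<Rightarrow> real^'d^'d" where
  "jump_tensor F v x =
     (if F \<in> interior_facets T
      then tensor (trace_from (P F) v x) (n_plus F)
           + tensor (trace_from (minus_elem T P F) v x) (n_minus F)
      else tensor (trace_from (P F) v x) (n_plus F))"

definition avg_grad :: "(real^'d) set \<Rightarrow> (real^'d \<Rightarrow> real^'d) \<Rightarrow> real^'d \<Rightarrow> real^'d^'d" where
  "avg_grad F v x =
     (if F \<in> interior_facets T
      then (1/2) *\<^sub>R (trace_from (P F) (grad v) x + trace_from (minus_elem T P F) (grad v) x)
      else trace_from (P F) (grad v) x)"

section \<open>Norms and forms\<close>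

definition norm_1h :: "(real^'d \<Rightarrow> real^'d) \<Rightarrow> real" where
  "norm_1h v = sqrt
     ((\<Sum>K\<in>T. elem_int K (\<lambda>x. (norm (grad v x))\<^sup>2))
      + (\<Sum>F\<in>facets T. facet_int F (\<lambda>x. inverse (facet_size F) * (norm (jump_tensor F v x))\<^sup>2)))"

definition a_form :: "real \<Rightarrow> (real^'d \<Rightarrow> real^'d) \<Rightarrow> (real^'d \<Rightarrow> real^'d) \<Rightarrow> real" where
  "a_form \<eta> u v =
     (\<Sum>K\<in>T. elem_int K (\<lambda>x. grad u x \<bullet> grad v x))
     + (\<Sum>F\<in>facets T. facet_int F (\<lambda>x. \<eta> / facet_size F * (jump F u x \<bullet> jump F v x)))
     - (\<Sum>F\<in>facets T. facet_int F (\<lambda>x. tensor (jump F u x) (n_plus F) \<bullet> avg_grad F v x))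
     - (\<Sum>F\<in>facets T. facet_int F (\<lambda>x. tensor (jump F v x) (n_plus F) \<bullet> avg_grad F u x))"

definition b_form :: "(real^'d \<Rightarrow> real) \<times> (real^'d \<Rightarrow> real) \<Rightarrow> (real^'d \<Rightarrow> real^'d) \<Rightarrow> real" where
  "b_form = (\<lambda>(p, \<mu>) v.
     - (\<Sum>K\<in>T. elem_int K (\<lambda>x. p x * divergence v x))
     + (\<Sum>F\<in>facets T. facet_int F (\<lambda>x. jump_normal F v x * \<mu> x)))"

end

definition norm_L2 :: "(real^'d) set \<Rightarrow> (real^'d \<Rightarrow> real) \<Rightarrow> real" where
  "norm_L2 \<Omega> q = sqrt (LINT x:\<Omega>|lborel. (q x)\<^sup>2)"

definition norm_lam :: "(real^'d) set set \<Rightarrow> (real^'d \<Rightarrow> real) \<Rightarrow> real" where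
  "norm_lam T \<xi> = sqrt (\<Sum>F\<in>facets T. facet_size F * facet_int F (\<lambda>x. (\<xi> x)\<^sup>2))"

section \<open>Bases and matrices\<close>

definition lin_comb :: "nat \<Rightarrow> (nat \<Rightarrow> 'a \<Rightarrow> 'b::real_vector) \<Rightarrow> real Matrix.vec \<Rightarrow> 'a \<Rightarrow> 'b" where
  "lin_comb n \<phi> c = (\<lambda>x. \<Sum>j<n. vec_index c j *\<^sub>R \<phi> j x)"

definition is_basis :: "('a \<Rightarrow> 'b::real_vector) set \<Rightarrow> nat \<Rightarrow> (nat \<Rightarrow> 'a \<Rightarrow> 'b) \<Rightarrow> bool" where
  "is_basis V n \<phi> \<longleftrightarrow>
     (\<forall>j<n. \<phi> j \<in> V) \<and>
     (\<forall>f\<in>V. \<exists>c\<in>carrier_vec n. f = lin_comb n \<phi> c) \<and>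
     (\<forall>c\<in>carrier_vec n. lin_comb n \<phi> c = (\<lambda>_. 0) \<longrightarrow> c = 0\<^sub>v n)"

definition bilin :: "real Matrix.vec \<Rightarrow> real mat \<Rightarrow> real Matrix.vec \<Rightarrow> real" where
  "bilin x A y = scalar_prod x (A *\<^sub>v y)"

definition sym_mat :: "nat \<Rightarrow> real mat \<Rightarrow> bool" where
  "sym_mat n A \<longleftrightarrow> A \<in> carrier_mat n n \<and> transpose_mat A = A"

definition spd_mat :: "nat \<Rightarrow> real mat \<Rightarrow> bool" where
  "spd_mat n A \<longleftrightarrow> sym_mat n A \<and> (\<forall>v\<in>carrier_vec n. v \<noteq> 0\<^sub>v n \<longrightarrow> bilin v A v > 0)"

definition spectrally_equivalent ::
    "real set \<Rightarrow> (real \<Rightarrow> nat) \<Rightarrow> (real \<Rightarrow> real mat) \<Rightarrow> (real \<Rightarrow> real mat) \<Rightarrow> bool" where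
  "spectrally_equivalent H n At A \<longleftrightarrow>
     (\<forall>h\<in>H. spd_mat (n h) (At h)) \<and>
     (\<exists>\<delta>>0. \<exists>\<Delta>>0. \<forall>h\<in>H. \<forall>v\<in>carrier_vec (n h).
        \<delta> * bilin v (At h) v \<le> bilin v (A h) v \<and> bilin v (A h) v \<le> \<Delta> * bilin v (At h) v)"

text \<open>\<open>B @\<^sub>r C\<close> stacks \<open>B\<close> on top of \<open>C\<close>; its transpose is the block row of the transposes.\<close>

definition saddle_mat :: "real mat \<Rightarrow> real mat \<Rightarrow> real mat \<Rightarrow> real mat" where
  "saddle_mat A B C =
     four_block_mat A (transpose_mat (B @\<^sub>r C))
                    (B @\<^sub>r C) (0\<^sub>m (dim_row B + dim_row C) (dim_row B + dim_row C))"

end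

theory Submission
  imports Defs
begin

text \<open>Because \<open>PP\<close> is symmetric positive definite and \<open>AA\<close> symmetric, every eigenvalue of
  \<open>PP\<^sup>-\<^sup>1 AA\<close> is real and comes with a real pair \<open>(v, y)\<close> solving \<open>A v + D\<^sup>T y = \<rho> At v\<close>,
  \<open>D v = \<rho> S y\<close>, where \<open>D\<close> stacks \<open>B\<close> and \<open>C\<close>, and \<open>S = bdiag(Q, M)\<close>.  Boundedness gives
  the upper bound for \<open>|\<rho>|\<close>.  If \<open>\<rho> > 0\<close>, testing with \<open>v\<close> gives
  \<open>\<delta> v\<^sup>T At v \<le> v\<^sup>T A v + \<rho> y\<^sup>T S y = \<rho> v\<^sup>T At v\<close>.  If \<open>\<rho> = -t \<le> 0\<close>, the inf-sup condition applied
  to \<open>D\<^sup>T y = -(A + t At) v\<close> bounds \<open>t\<close> from below.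

  That \<open>Q\<close> and \<open>M\<close> are positive definite is not a hypothesis: it holds because the discrete
  functions are polynomial on the open elements and facets, so that a vanishing \<open>L\<^sup>2\<close> norm forces
  them to vanish identically.\<close>

section \<open>Bilinear forms of matrices and positive definiteness\<close>

lemma bilin_add_right:
  assumes "A \<in> carrier_mat m n" "x \<in> carrier_vec m" "y \<in> carrier_vec n" "z \<in> carrier_vec n"
  shows "bilin x A (y + z) = bilin x A y + bilin x A z"
  using assms unfolding bilin_def
  by (simp add: mult_add_distrib_mat_vec[of A m n] scalar_prod_add_distrib[of _ m])

lemma bilin_add_left:
  assumes "A \<in> carrier_mat m n" "x \<in> carrier_vec m" "w \<in> carrier_vec m" "z \<in> carrier_vec n"
  shows "bilin (x + w) A z = bilin x A z + bilin w A z"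
  using assms unfolding bilin_def
  by (simp add: add_scalar_prod_distrib[of _ m])

lemma bilin_smult_right:
  assumes "A \<in> carrier_mat m n" "x \<in> carrier_vec m" "y \<in> carrier_vec n"
  shows "bilin x A (c \<cdot>\<^sub>v y) = c * bilin x A y"
  using assms unfolding bilin_def by (simp add: mult_mat_vec[of A m n])

lemma bilin_smult_left:
  assumes "A \<in> carrier_mat m n" "x \<in> carrier_vec m" "y \<in> carrier_vec n"
  shows "bilin (c \<cdot>\<^sub>v x) A y = c * bilin x A y"
  using assms unfolding bilin_def by (simp add: smult_scalar_prod_distrib[of _ m])

lemma bilin_zero_left:
  assumes "A \<in> carrier_mat m n" "y \<in> carrier_vec n"
  shows "bilin (0\<^sub>v m) A y = 0"
  using assms unfolding bilin_def by simp

lemma bilin_zero_right: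
  assumes "A \<in> carrier_mat m n" "x \<in> carrier_vec m"
  shows "bilin x A (0\<^sub>v n) = 0"
proof -
  have "A *\<^sub>v 0\<^sub>v n = 0\<^sub>v m" using assms by (intro eq_vecI) auto
  then show ?thesis using assms unfolding bilin_def by simp
qed

lemma bilin_transpose:
  assumes "A \<in> carrier_mat m n" "x \<in> carrier_vec n" "y \<in> carrier_vec m"
  shows "bilin x (transpose_mat A) y = bilin y A x"
  using assms transpose_vec_mult_scalar[OF assms] unfolding bilin_def
  by (metis comm_scalar_prod mult_mat_vec_carrier transpose_carrier_mat)

lemma bilin_commute:
  assumes "sym_mat n A" "x \<in> carrier_vec n" "y \<in> carrier_vec n"
  shows "bilin x A y = bilin y A x"
  using assms bilin_transpose[of A n n x y] unfolding sym_mat_def by auto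

text \<open>For \<open>c > 0\<close> this is the value of the quadratic at its minimizer. For
  \<open>c = 0\<close> the expression is affine in \<open>t\<close> and can stay nonnegative only
  with zero slope, so semidefinite forms are covered too.\<close>

lemma quadratic_nonneg_discriminant:
  fixes a b c :: real
  assumes "\<And>t. 0 \<le> a + 2 * t * b + t\<^sup>2 * c" "c \<ge> 0"
  shows "b\<^sup>2 \<le> a * c"
proof (cases "c = 0")
  case True
  have "b = 0"
  proof (rule ccontr)
    assume "b \<noteq> 0"
    \<comment> \<open>This \<open>t\<close> sends the affine function to
      \<open>a - \<bar>a\<bar> - 1\<close>, which is negative.\<close>
    then have "2 * (- (\<bar>a\<bar> + 1) / (2 * b)) * b = - (\<bar>a\<bar> + 1)" by simp
    then show False using assms(1)[of "- (\<bar>a\<bar> + 1) / (2 * b)"] True by auto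
  qed
  then show ?thesis using True by simp
next
  case False
  then have c: "c > 0" using assms by simp
  have "0 \<le> a + 2 * (- b / c) * b + (- b / c)\<^sup>2 * c" by (rule assms(1))
  then have "0 \<le> a - b\<^sup>2 / c" using c by (simp add: power2_eq_square field_simps)
  then show ?thesis using c by (simp add: field_simps)
qed

text \<open>Nonnegativity of the form along the line through \<open>x\<close> in direction
  \<open>y\<close> gives a nonnegative quadratic in \<open>t\<close>, whose discriminant bound is
  the claim.\<close>

lemma bilin_cauchy_schwarz:
  assumes E: "sym_mat n E" and nn: "\<And>w. w \<in> carrier_vec n \<Longrightarrow> bilin w E w \<ge> 0"
    and x: "x \<in> carrier_vec n" and y: "y \<in> carrier_vec n"
  shows "(bilin x E y)\<^sup>2 \<le> bilin x E x * bilin y E y"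
proof (rule quadratic_nonneg_discriminant)
  have E': "E \<in> carrier_mat n n" using E by (simp add: sym_mat_def)
  fix t
  have "0 \<le> bilin (x + t \<cdot>\<^sub>v y) E (x + t \<cdot>\<^sub>v y)" using nn x y by simp
  also have "\<dots> = bilin x E x + 2 * t * bilin x E y + t\<^sup>2 * bilin y E y"
    using x y E' bilin_commute[OF E x y]
    by (simp add: bilin_add_left[of E n n] bilin_add_right[of E n n]
        bilin_smult_left[of E n n] bilin_smult_right[of E n n] power2_eq_square algebra_simps)
  finally show "0 \<le> bilin x E x + 2 * t * bilin x E y + t\<^sup>2 * bilin y E y" .
qed (use nn y in auto)

lemma spd_mat_nonneg:
  assumes "spd_mat n A" "x \<in> carrier_vec n"
  shows "bilin x A x \<ge> 0"
  using assms bilin_zero_left[of A n n x] unfolding spd_mat_def sym_mat_def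
  by (cases "x = 0\<^sub>v n") (auto intro: less_imp_le)

text \<open>Positive definiteness leaves only the trivial kernel, hence a nonzero determinant; so
  \<open>mat_inverse\<close> returns a genuine inverse and \<open>the (mat_inverse A)\<close> is
  meaningful.\<close>

lemma spd_mat_inverse:
  assumes "spd_mat n A"
  obtains B where "mat_inverse A = Some B" "A * B = 1\<^sub>m n" "B * A = 1\<^sub>m n"
    "B \<in> carrier_mat n n"
proof -
  have A: "A \<in> carrier_mat n n" using assms by (simp add: spd_mat_def sym_mat_def)
  have "\<not> (\<exists>v. v \<in> carrier_vec n \<and> v \<noteq> 0\<^sub>v n \<and> A *\<^sub>v v = 0\<^sub>v n)"
    using assms unfolding spd_mat_def bilin_def by force
  then have "Determinant.det A \<noteq> 0" using det_0_iff_vec_prod_zero_field[OF A] by simp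
  then have "A \<in> Units (ring_mat TYPE(real) n ())" by (rule det_non_zero_imp_unit[OF A])
  then obtain B where "mat_inverse A = Some B"
    using mat_inverse(1)[OF A] by (metis not_None_eq)
  with mat_inverse(2)[OF A this] that show thesis by blast
qed

lemma spd_mat_invertible:
  assumes "spd_mat n A"
  shows "invertible_mat A"
proof -
  obtain B where "mat_inverse A = Some B" "A * B = 1\<^sub>m n" "B * A = 1\<^sub>m n" "B \<in> carrier_mat n n"
    by (rule spd_mat_inverse[OF assms])
  moreover have "A \<in> carrier_mat n n" using assms by (simp add: spd_mat_def sym_mat_def)
  ultimately show ?thesis unfolding invertible_mat_def inverts_mat_def by auto
qed

section \<open>Real eigenvalues of symmetric pencils\<close>

lemma Re_Im_mult_mat_vec:
  assumes "R \<in> carrier_mat m n" "x \<in> carrier_vec n"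
  shows "map_vec Re (map_mat complex_of_real R *\<^sub>v x) = R *\<^sub>v map_vec Re x"
    and "map_vec Im (map_mat complex_of_real R *\<^sub>v x) = R *\<^sub>v map_vec Im x"
  using assms by (auto intro!: eq_vecI simp: scalar_prod_def)

text \<open>Split a complex eigenvector into real and imaginary parts \<open>a\<close> and
  \<open>b\<close>. Symmetry forces the imaginary part \<open>s\<close> of the eigenvalue to vanish,
  after which \<open>a\<close> and \<open>b\<close> both solve the real equation; whichever is
  nonzero serves as \<open>x\<close>.\<close>

lemma symmetric_pencil_eigenvalue_real:
  assumes A: "sym_mat n A" and P: "spd_mat n P"
    and ev: "eigenvalue (map_mat complex_of_real (the (mat_inverse P) * A)) \<rho>"
  obtains r x where "\<rho> = complex_of_real r" "x \<in> carrier_vec n" "x \<noteq> 0\<^sub>v n"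
    "A *\<^sub>v x = r \<cdot>\<^sub>v (P *\<^sub>v x)"
proof -
  obtain B where B: "mat_inverse P = Some B" "P * B = 1\<^sub>m n" "B \<in> carrier_mat n n"
    using spd_mat_inverse[OF P] by metis
  have Ac: "A \<in> carrier_mat n n" and Pc: "P \<in> carrier_mat n n" and Ps: "sym_mat n P"
    using A P by (auto simp: spd_mat_def sym_mat_def)
  define R where "R = B * A"
  have R: "R \<in> carrier_mat n n" using B Ac by (simp add: R_def)
  \<comment> \<open>Applying \<open>P\<close> undoes the inverse: \<open>R\<close> is in general not
    symmetric, but \<open>P\<close> and \<open>P * R = A\<close> are.\<close>
  have PR: "P *\<^sub>v (R *\<^sub>v v) = A *\<^sub>v v" if "v \<in> carrier_vec n" for v
  proof -
    have "P *\<^sub>v (R *\<^sub>v v) = (P * B) *\<^sub>v (A *\<^sub>v v)"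
      unfolding R_def using B(3) Ac Pc that
      by (metis assoc_mult_mat_vec mult_mat_vec_carrier)
    then show ?thesis using B Ac that by simp
  qed
  obtain z where z: "z \<in> carrier_vec n" "z \<noteq> 0\<^sub>v n"
    "map_mat complex_of_real R *\<^sub>v z = \<rho> \<cdot>\<^sub>v z"
    using ev R unfolding B(1) option.sel R_def[symmetric] eigenvalue_def eigenvector_def by auto
  define a where "a = map_vec Re z"
  define b where "b = map_vec Im z"
  define r where "r = Re \<rho>"
  define s where "s = Im \<rho>"
  have ab: "a \<in> carrier_vec n" "b \<in> carrier_vec n" using z by (auto simp: a_def b_def)
  have Ra: "R *\<^sub>v a = r \<cdot>\<^sub>v a + (- s) \<cdot>\<^sub>v b"
    unfolding a_def Re_Im_mult_mat_vec(1)[OF R z(1), symmetric] z(3)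
    using z(1) by (auto intro!: eq_vecI simp: b_def r_def s_def)
  have Rb: "R *\<^sub>v b = s \<cdot>\<^sub>v a + r \<cdot>\<^sub>v b"
    unfolding b_def Re_Im_mult_mat_vec(2)[OF R z(1), symmetric] z(3)
    using z(1) by (auto intro!: eq_vecI simp: a_def r_def s_def)
  have Aa: "A *\<^sub>v a = r \<cdot>\<^sub>v (P *\<^sub>v a) + (- s) \<cdot>\<^sub>v (P *\<^sub>v b)"
    using PR[OF ab(1)] ab Pc unfolding Ra
    by (simp add: mult_add_distrib_mat_vec[of P n n] mult_mat_vec[of P n n])
  have Ab: "A *\<^sub>v b = s \<cdot>\<^sub>v (P *\<^sub>v a) + r \<cdot>\<^sub>v (P *\<^sub>v b)"
    using PR[OF ab(2)] ab Pc unfolding Rb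
    by (simp add: mult_add_distrib_mat_vec[of P n n] mult_mat_vec[of P n n])
  \<comment> \<open>Each equation is tested with the other part. By symmetry the two left sides
    agree and the \<open>r\<close> terms cancel, leaving \<open>s\<close> times a sum of two
    quadratic forms of \<open>P\<close>.\<close>
  have "bilin b A a = r * bilin b P a - s * bilin b P b"
    unfolding bilin_def Aa using ab Pc
    by (simp add: scalar_prod_add_distrib[of _ n] scalar_prod_smult_distrib[of _ n])
  moreover have "bilin a A b = s * bilin a P a + r * bilin a P b"
    unfolding bilin_def Ab using ab Pc
    by (simp add: scalar_prod_add_distrib[of _ n] scalar_prod_smult_distrib[of _ n])
  ultimately have *: "s * (bilin a P a + bilin b P b) = 0"
    using bilin_commute[OF A ab] bilin_commute[OF Ps ab] by (simp add: algebra_simps)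
  have nz: "a \<noteq> 0\<^sub>v n \<or> b \<noteq> 0\<^sub>v n"
  proof (rule ccontr)
    assume "\<not> ?thesis"
    then have ab0: "a = 0\<^sub>v n" "b = 0\<^sub>v n" by auto
    have "vec_index z i = 0" if "i < n" for i
    proof -
      have "Re (vec_index z i) = vec_index a i" "Im (vec_index z i) = vec_index b i"
        using that z(1) by (auto simp: a_def b_def)
      then show ?thesis using that by (simp add: ab0 complex_eq_iff)
    qed
    then have "z = 0\<^sub>v n" using z(1) by (intro eq_vecI) auto
    with z show False by simp
  qed
  then have "bilin a P a + bilin b P b > 0"
    using P ab spd_mat_nonneg[OF P ab(1)] spd_mat_nonneg[OF P ab(2)]
    by (auto simp: spd_mat_def add_pos_nonneg add_nonneg_pos)
  with * have s: "s = 0" by auto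
  then have rho: "\<rho> = complex_of_real r" by (simp add: r_def s_def complex_eq_iff)
  have "A *\<^sub>v a = r \<cdot>\<^sub>v (P *\<^sub>v a)" "A *\<^sub>v b = r \<cdot>\<^sub>v (P *\<^sub>v b)"
    unfolding Aa Ab s using ab Pc by (auto intro!: eq_vecI)
  with nz ab rho that show thesis by blast
qed

section \<open>Block matrices and the saddle-point eigenvalue bounds\<close>

lemma spd_four_block_mat:
  assumes A: "spd_mat n A" and B: "spd_mat m B"
  shows "spd_mat (n + m) (four_block_mat A (0\<^sub>m n m) (0\<^sub>m m n) B)" (is "spd_mat _ ?D")
    and "\<And>x y u w. \<lbrakk>x \<in> carrier_vec n; y \<in> carrier_vec m; u \<in> carrier_vec n; w \<in> carrier_vec m\<rbrakk> \<Longrightarrow>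
      bilin (x @\<^sub>v y) (four_block_mat A (0\<^sub>m n m) (0\<^sub>m m n) B) (u @\<^sub>v w) = bilin x A u + bilin y B w"
proof -
  have Ac: "A \<in> carrier_mat n n" and Bc: "B \<in> carrier_mat m m"
    and t: "transpose_mat A = A" "transpose_mat B = B"
    using A B by (auto simp: spd_mat_def sym_mat_def)
  show eq: "bilin (x @\<^sub>v y) ?D (u @\<^sub>v w) = bilin x A u + bilin y B w"
    if "x \<in> carrier_vec n" "y \<in> carrier_vec m" "u \<in> carrier_vec n" "w \<in> carrier_vec m"
    for x y u w :: "real Matrix.vec"
    using that Ac Bc unfolding bilin_def
    by (simp add: mult_mat_vec_split scalar_prod_append[of _ n _ m])
  have "sym_mat (n + m) ?D"
    unfolding sym_mat_def using Ac Bc t by (simp add: transpose_four_block_mat[of _ n n _ m _ m])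
  moreover have "\<forall>v\<in>carrier_vec (n + m). v \<noteq> 0\<^sub>v (n + m) \<longrightarrow> bilin v ?D v > 0"
    unfolding all_vec_append
  proof (intro ballI impI)
    fix x y :: "real Matrix.vec"
    assume x: "x \<in> carrier_vec n" and y: "y \<in> carrier_vec m"
      and nz: "x @\<^sub>v y \<noteq> 0\<^sub>v (n + m)"
    have "x \<noteq> 0\<^sub>v n \<or> y \<noteq> 0\<^sub>v m" using nz by auto
    then show "bilin (x @\<^sub>v y) ?D (x @\<^sub>v y) > 0"
      unfolding eq[OF x y x y] using A B x y spd_mat_nonneg[OF A x] spd_mat_nonneg[OF B y]
      by (auto simp: spd_mat_def add_pos_nonneg add_nonneg_pos)
  qed
  ultimately show "spd_mat (n + m) ?D" by (simp add: spd_mat_def)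
qed

text \<open>The nested form groups the last two blocks, so that pressure and facet multiplier act as
  one dual variable and the preconditioner becomes a two-by-two block matrix.\<close>

lemma diag_block_mat_three:
  assumes "A \<in> carrier_mat n n" "B \<in> carrier_mat m m" "C \<in> carrier_mat l l"
  shows "diag_block_mat [A, B, C] =
    four_block_mat A (0\<^sub>m n (m + l)) (0\<^sub>m (m + l) n) (four_block_mat B (0\<^sub>m m l) (0\<^sub>m l m) C)"
  using assms
  by (simp add: diag_block_mat.simps(2)[of A "[B, C]"] diag_block_mat.simps(2)[of B "[C]"] Let_def
      del: diag_block_mat.simps)

text \<open>The transposed block is moved to the other argument, so that both coupling terms are
  expressed through \<open>B @\<^sub>r C\<close> alone, the form in which boundedness and inf-sup
  are available.\<close>

lemma bilin_saddle_mat: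
  assumes A: "A \<in> carrier_mat n n" and B: "B \<in> carrier_mat m n" and C: "C \<in> carrier_mat l n"
    and "x \<in> carrier_vec n" "y \<in> carrier_vec (m + l)" "u \<in> carrier_vec n" "w \<in> carrier_vec (m + l)"
  shows "bilin (x @\<^sub>v y) (saddle_mat A B C) (u @\<^sub>v w) =
    bilin x A u + bilin w (B @\<^sub>r C) x + bilin y (B @\<^sub>r C) u"
proof -
  have BC: "B @\<^sub>r C \<in> carrier_mat (m + l) n" using B C by simp
  have "saddle_mat A B C *\<^sub>v (u @\<^sub>v w) =
      (A *\<^sub>v u + transpose_mat (B @\<^sub>r C) *\<^sub>v w) @\<^sub>v ((B @\<^sub>r C) *\<^sub>v u + 0\<^sub>m (m + l) (m + l) *\<^sub>v w)"
    unfolding saddle_mat_def using assms BC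
    by (subst four_block_mat_mult_vec[of _ n n _ "m + l" _ "m + l"]) auto
  moreover have "0\<^sub>m (m + l) (m + l) *\<^sub>v w = 0\<^sub>v (m + l)" using assms by auto
  moreover have "transpose_mat (B @\<^sub>r C) *\<^sub>v w \<in> carrier_vec n" "(B @\<^sub>r C) *\<^sub>v u \<in> carrier_vec (m + l)"
    "A *\<^sub>v u \<in> carrier_vec n"
    using assms BC by (auto simp del: carrier_append_rows intro: mult_mat_vec_carrier)
  ultimately show ?thesis
    using assms bilin_transpose[OF BC, of x w] unfolding bilin_def
    by (simp add: scalar_prod_append[of _ n _ "m + l"] scalar_prod_add_distrib[of _ n])
qed

lemma sym_saddle_mat:
  assumes A: "sym_mat n A" and B: "B \<in> carrier_mat m n" and C: "C \<in> carrier_mat l n"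
  shows "sym_mat (n + (m + l)) (saddle_mat A B C)"
proof -
  have BC: "B @\<^sub>r C \<in> carrier_mat (m + l) n" using B C by simp
  then show ?thesis
    using A B C unfolding saddle_mat_def sym_mat_def
    by (simp add: transpose_four_block_mat[of _ n n _ "m + l" _ "m + l"])
qed

lemma bilin_append_rows:
  assumes "B \<in> carrier_mat m n" "C \<in> carrier_mat l n"
    "q \<in> carrier_vec m" "\<xi> \<in> carrier_vec l" "v \<in> carrier_vec n"
  shows "bilin (q @\<^sub>v \<xi>) (B @\<^sub>r C) v = bilin q B v + bilin \<xi> C v"
  using assms unfolding bilin_def
  by (simp add: mat_mult_append[of B m n C l] scalar_prod_append[of _ m _ l])

text \<open>For a negative eigenvalue \<open>-t\<close> the first block equation says that \<open>D\<^sup>T y\<close> is represented by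
  \<open>E = A + t At\<close> at \<open>-v\<close>; Cauchy-Schwarz for \<open>E\<close> turns the inf-sup condition into
  \<open>g \<le> t (1 + t / \<delta>)\<close>.\<close>

lemma saddle_eigenpair_bounds:
  fixes \<rho> \<delta> \<Delta> \<kappa> g :: real
  assumes A: "sym_mat n A" and At: "spd_mat n At" and S: "spd_mat m S"
    and D: "D \<in> carrier_mat m n"
    and pos: "\<delta> > 0" "\<Delta> > 0" "\<kappa> > 0" "g > 0"
    and lower: "\<And>v. v \<in> carrier_vec n \<Longrightarrow> \<delta> * bilin v At v \<le> bilin v A v"
    and upper: "\<And>v. v \<in> carrier_vec n \<Longrightarrow> bilin v A v \<le> \<Delta> * bilin v At v"
    and bounded: "\<And>y v. y \<in> carrier_vec m \<Longrightarrow> v \<in> carrier_vec n \<Longrightarrow>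
      (bilin y D v)\<^sup>2 \<le> \<kappa> * bilin v A v * bilin y S y"
    and infsup: "\<And>y K. y \<in> carrier_vec m \<Longrightarrow> K \<ge> 0 \<Longrightarrow>
      (\<And>w. w \<in> carrier_vec n \<Longrightarrow> (bilin y D w)\<^sup>2 \<le> K * bilin w A w) \<Longrightarrow> g * bilin y S y \<le> K"
    and v: "v \<in> carrier_vec n" and y: "y \<in> carrier_vec m" and nz: "v \<noteq> 0\<^sub>v n \<or> y \<noteq> 0\<^sub>v m"
    and eq1: "\<And>w. w \<in> carrier_vec n \<Longrightarrow> bilin w A v + bilin y D w = \<rho> * bilin w At v"
    and eq2: "\<And>z. z \<in> carrier_vec m \<Longrightarrow> bilin z D v = \<rho> * bilin z S y"
  shows "\<rho> \<in> {- (\<Delta> + 1 + \<kappa> * \<Delta>) .. - min \<delta> (g / 2)} \<union> {\<delta> .. \<Delta> + 1 + \<kappa> * \<Delta>}"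
proof -
  have Ac: "A \<in> carrier_mat n n" and Atc: "At \<in> carrier_mat n n" and Sc: "S \<in> carrier_mat m m"
    and Ats: "sym_mat n At"
    using A At S by (auto simp: spd_mat_def sym_mat_def)
  let ?a = "bilin v A v" and ?t = "bilin v At v" and ?s = "bilin y S y" and ?d = "bilin y D v"
  have t0: "?t \<ge> 0" by (rule spd_mat_nonneg[OF At v])
  have s0: "?s \<ge> 0" by (rule spd_mat_nonneg[OF S y])
  have Ann: "bilin w A w \<ge> 0" if "w \<in> carrier_vec n" for w
    using lower[OF that] spd_mat_nonneg[OF At that] pos(1)
    by (meson mult_nonneg_nonneg less_imp_le order_trans)
  have e1: "?a + ?d = \<rho> * ?t" by (rule eq1[OF v])
  have e2: "?d = \<rho> * ?s" by (rule eq2[OF y])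
  have ts: "?t + ?s > 0"
    using nz At S v y t0 s0 by (auto simp: spd_mat_def add_pos_nonneg add_nonneg_pos)
  have d2: "?d\<^sup>2 \<le> (\<kappa> * \<Delta> * ?t) * ?s"
  proof -
    have "?d\<^sup>2 \<le> \<kappa> * ?a * ?s" by (rule bounded[OF y v])
    also have "\<dots> \<le> \<kappa> * (\<Delta> * ?t) * ?s"
      using upper[OF v] pos s0 by (intro mult_right_mono mult_left_mono) auto
    finally show ?thesis by (simp add: mult.assoc)
  qed
  \<comment> \<open>The arithmetic-geometric mean inequality applied to the two factors of
    \<open>d2\<close>, in the form \<open>4 p q \<le> (p + q)^2\<close>.\<close>
  have d1: "2 * \<bar>?d\<bar> \<le> \<kappa> * \<Delta> * ?t + ?s"
  proof -
    have "(2 * \<bar>?d\<bar>)\<^sup>2 \<le> 4 * ((\<kappa> * \<Delta> * ?t) * ?s)" using d2 by (simp add: power_mult_distrib)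
    also have "\<dots> \<le> (\<kappa> * \<Delta> * ?t + ?s)\<^sup>2"
      using zero_le_power2[of "\<kappa> * \<Delta> * ?t - ?s"] by (simp add: power2_eq_square algebra_simps)
    finally show ?thesis by (rule power2_le_imp_le) (use pos t0 s0 in auto)
  qed
  have abs_bd: "\<bar>\<rho>\<bar> \<le> \<Delta> + 1 + \<kappa> * \<Delta>"
  proof -
    \<comment> \<open>A Rayleigh quotient: adding \<open>e1\<close> and \<open>e2\<close> tests the
      whole eigenvalue equation with its own eigenvector, and \<open>?t + ?s\<close> is the squared
      preconditioner norm of that eigenvector.\<close>
    have "\<bar>\<rho>\<bar> * (?t + ?s) = \<bar>\<rho> * (?t + ?s)\<bar>" using ts by (simp add: abs_mult)
    also have "\<rho> * (?t + ?s) = ?a + 2 * ?d" using e1 e2 by (simp add: algebra_simps)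
    also have "\<bar>?a + 2 * ?d\<bar> \<le> ?a + 2 * \<bar>?d\<bar>" using Ann[OF v] by linarith
    also have "\<dots> \<le> \<Delta> * ?t + (\<kappa> * \<Delta> * ?t + ?s)" using upper[OF v] d1 by linarith
    also have "\<dots> \<le> (\<Delta> + 1 + \<kappa> * \<Delta>) * (?t + ?s)"
      using pos t0 s0 by (simp add: algebra_simps)
    finally show ?thesis using ts mult_le_cancel_right_pos[OF ts] by blast
  qed
  show ?thesis
  proof (cases "\<rho> > 0")
    case True
    \<comment> \<open>Were \<open>?t\<close> zero, \<open>d2\<close> would kill the coupling term
      and \<open>e2\<close> then \<open>?s\<close>, against \<open>ts\<close>. A positive
      \<open>?t\<close> may be cancelled from \<open>\<delta> * ?t \<le> \<rho> * ?t\<close>, which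
      holds because the coupling term \<open>\<rho> * ?s\<close> is nonnegative.\<close>
    have "?t > 0"
    proof (rule ccontr)
      assume "\<not> ?thesis"
      then have t: "?t = 0" using t0 by simp
      then have "?d = 0" using d2 by simp
      then have "?s = 0" using e2 True by simp
      then show False using t ts by simp
    qed
    moreover have "\<delta> * ?t \<le> \<rho> * ?t"
      using lower[OF v] e1 e2 True s0 by (smt (verit) mult_nonneg_nonneg)
    ultimately have "\<delta> \<le> \<rho>" by simp
    then show ?thesis using abs_bd by auto
  next
    case False
    \<comment> \<open>The case \<open>\<rho> = 0\<close> is included here; the final bound on
      \<open>\<tau>\<close> is positive and so excludes it.\<close>
    define \<tau> where "\<tau> = - \<rho>"
    have tau: "\<tau> \<ge> 0" using False by (simp add: \<tau>_def)
    define E where "E = A + \<tau> \<cdot>\<^sub>m At"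
    have E: "bilin x E z = bilin x A z + \<tau> * bilin x At z"
      if "x \<in> carrier_vec n" "z \<in> carrier_vec n" for x z
    proof -
      have "(\<tau> \<cdot>\<^sub>m At) *\<^sub>v z = \<tau> \<cdot>\<^sub>v (At *\<^sub>v z)"
        using that Atc by (intro eq_vecI) (auto simp: scalar_prod_def sum_distrib_left mult.assoc)
      then show ?thesis
        unfolding E_def bilin_def using that Ac Atc
        by (simp add: add_mult_distrib_mat_vec[of A n n] scalar_prod_add_distrib[of _ n])
    qed
    have "transpose_mat (\<tau> \<cdot>\<^sub>m At) = \<tau> \<cdot>\<^sub>m transpose_mat At" by (intro eq_matI) auto
    then have Es: "sym_mat n E"
      using A Ats unfolding E_def sym_mat_def by (simp add: transpose_add[of _ n n])
    have Enn: "bilin w E w \<ge> 0" if "w \<in> carrier_vec n" for w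
      using E[OF that that] Ann[OF that] spd_mat_nonneg[OF At that] tau by simp
    have yDw: "bilin y D w = - bilin w E v" if "w \<in> carrier_vec n" for w
      using eq1[OF that] E[OF that v] by (simp add: \<tau>_def)
    have Ev: "bilin v E v = \<tau> * ?s" using yDw[OF v] e2 by (simp add: \<tau>_def)
    \<comment> \<open>If \<open>?s\<close> vanished, so would the form of \<open>E\<close> at
      \<open>v\<close>, hence \<open>?a \<le> 0\<close>; the lower spectral bound then makes
      \<open>?t\<close> vanish as well, against \<open>ts\<close>.\<close>
    have spos: "?s > 0"
    proof (rule ccontr)
      assume "\<not> ?thesis"
      then have s: "?s = 0" using s0 by simp
      then have "?a \<le> 0" using Ev E[OF v v] mult_nonneg_nonneg[OF tau t0] by simp
      then have "\<delta> * ?t \<le> 0" using lower[OF v] by linarith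
      then show False using s ts pos(1) by (simp add: mult_le_0_iff)
    qed
    \<comment> \<open>The constant has two factors: \<open>At \<le> A / \<delta>\<close> bounds
      \<open>E\<close> by \<open>(1 + \<tau> / \<delta>) A\<close>, and \<open>Ev\<close> evaluates
      the form of \<open>E\<close> at \<open>v\<close> as \<open>\<tau> * ?s\<close>.\<close>
    have "g * ?s \<le> (1 + \<tau> / \<delta>) * (\<tau> * ?s)"
    proof (rule infsup[OF y])
      fix w :: "real Matrix.vec" assume w: "w \<in> carrier_vec n"
      have "(bilin y D w)\<^sup>2 = (bilin w E v)\<^sup>2" using yDw[OF w] by simp
      also have "\<dots> \<le> bilin w E w * bilin v E v" by (rule bilin_cauchy_schwarz[OF Es Enn w v])
      also have "\<dots> \<le> ((1 + \<tau> / \<delta>) * bilin w A w) * bilin v E v"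
      proof (rule mult_right_mono[OF _ Enn[OF v]])
        have "bilin w At w \<le> bilin w A w / \<delta>" using lower[OF w] pos(1) by (simp add: field_simps)
        then have "\<tau> * bilin w At w \<le> \<tau> * (bilin w A w / \<delta>)" using tau by (rule mult_left_mono)
        then show "bilin w E w \<le> (1 + \<tau> / \<delta>) * bilin w A w"
          using E[OF w w] by (simp add: algebra_simps)
      qed
      finally show "(bilin y D w)\<^sup>2 \<le> (1 + \<tau> / \<delta>) * (\<tau> * ?s) * bilin w A w"
        using Ev by (simp add: mult_ac)
    qed (use tau pos s0 in auto)
    then have g: "g \<le> (1 + \<tau> / \<delta>) * \<tau>" using spos by (simp add: mult.assoc[symmetric])
    \<comment> \<open>Instead of solving the quadratic inequality \<open>g\<close>, split at
      \<open>\<delta>\<close>: below it the factor \<open>1 + \<tau> / \<delta>\<close> is at most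
      2, whence \<open>g / 2 \<le> \<tau>\<close>.\<close>
    have "min \<delta> (g / 2) \<le> \<tau>"
    proof (cases "\<tau> < \<delta>")
      case True
      then have "1 + \<tau> / \<delta> \<le> 2" using pos(1) by simp
      then have "(1 + \<tau> / \<delta>) * \<tau> \<le> 2 * \<tau>" using tau by (rule mult_right_mono)
      then show ?thesis using g by simp
    qed simp
    then show ?thesis using abs_bd by (auto simp: \<tau>_def)
  qed
qed

section \<open>Polynomials, integrability and vanishing almost everywhere\<close>

lemma Pk_eq_continuous:
  assumes "f \<in> Pk k D"
  obtains g where "continuous_on UNIV g" "\<And>x. x \<in> D \<Longrightarrow> f x = g x"
proof -
  obtain c where c: "\<And>x. x \<in> D \<Longrightarrow>
      f x = (\<Sum>\<alpha> | sum \<alpha> UNIV \<le> k. c \<alpha> * (\<Prod>i\<in>UNIV. (x $ i) ^ \<alpha> i))"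
    using assms unfolding Pk_def by blast
  \<comment> \<open>\<open>Pk\<close> constrains \<open>f\<close> on \<open>D\<close> only, so the
    continuous function is the polynomial itself, taken on the whole space.\<close>
  show thesis
    by (rule that[of "\<lambda>x. \<Sum>\<alpha> | sum \<alpha> UNIV \<le> k. c \<alpha> * (\<Prod>i\<in>UNIV. (x $ i) ^ \<alpha> i)"])
      (auto simp: c intro!: continuous_intros)
qed

lemma Pk_sum:
  fixes D :: "(real^'d) set" and f :: "nat \<Rightarrow> real^'d \<Rightarrow> real"
  assumes "\<And>j. j < n \<Longrightarrow> f j \<in> Pk k D"
  shows "(\<lambda>x. \<Sum>j<n. a j * f j x) \<in> Pk k D"
proof -
  have "\<forall>j\<in>{..<n}. \<exists>c :: ('d \<Rightarrow> nat) \<Rightarrow> real. \<forall>x\<in>D.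
      f j x = (\<Sum>\<alpha> | sum \<alpha> UNIV \<le> k. c \<alpha> * (\<Prod>i\<in>UNIV. (x $ i) ^ \<alpha> i))"
    using assms unfolding Pk_def by blast
  from bchoice[OF this] obtain c :: "nat \<Rightarrow> ('d \<Rightarrow> nat) \<Rightarrow> real" where c: "\<forall>j\<in>{..<n}. \<forall>x\<in>D.
      f j x = (\<Sum>\<alpha> | sum \<alpha> UNIV \<le> k. c j \<alpha> * (\<Prod>i\<in>UNIV. (x $ i) ^ \<alpha> i))" ..
  have "(\<Sum>j<n. a j * f j x) =
      (\<Sum>\<alpha> | sum \<alpha> UNIV \<le> k. (\<Sum>j<n. a j * c j \<alpha>) * (\<Prod>i\<in>UNIV. (x $ i) ^ \<alpha> i))"
    if x: "x \<in> D" for x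
  proof -
    have "(\<Sum>j<n. a j * f j x) =
        (\<Sum>j<n. \<Sum>\<alpha> | sum \<alpha> UNIV \<le> k. a j * c j \<alpha> * (\<Prod>i\<in>UNIV. (x $ i) ^ \<alpha> i))"
      using x by (intro sum.cong) (auto simp: c sum_distrib_left mult.assoc)
    also have "\<dots> = (\<Sum>\<alpha> | sum \<alpha> UNIV \<le> k. \<Sum>j<n. a j * c j \<alpha> * (\<Prod>i\<in>UNIV. (x $ i) ^ \<alpha> i))"
      by (rule sum.swap)
    finally show ?thesis by (simp only: sum_distrib_right)
  qed
  then show ?thesis
    unfolding Pk_def by (intro CollectI exI[of _ "\<lambda>\<alpha>. \<Sum>j<n. a j * c j \<alpha>"] ballI)
qed

lemma Pk_const: "(\<lambda>_. c) \<in> Pk k (D :: (real^'d) set)"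
proof -
  \<comment> \<open>A sum over an infinite index set is \<open>0\<close> by convention; finiteness
    of the multi-indices lets the constant term survive.\<close>
  have fin: "finite {\<alpha> :: 'd \<Rightarrow> nat. sum \<alpha> UNIV \<le> k}"
  proof (rule finite_subset)
    have "\<alpha> i \<le> sum \<alpha> UNIV" for \<alpha> :: "'d \<Rightarrow> nat" and i
      by (rule member_le_sum) auto
    then show "{\<alpha> :: 'd \<Rightarrow> nat. sum \<alpha> UNIV \<le> k} \<subseteq> UNIV \<rightarrow>\<^sub>E {..k}"
      by (fastforce intro: order_trans)
    show "finite ((UNIV :: 'd set) \<rightarrow>\<^sub>E {..k})" by (intro finite_PiE) auto
  qed
  let ?c = "\<lambda>\<alpha> :: 'd \<Rightarrow> nat. if \<alpha> = (\<lambda>_. 0) then c else 0"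
  have "c = (\<Sum>\<alpha> | sum \<alpha> UNIV \<le> k. ?c \<alpha> * (\<Prod>i\<in>UNIV. (x $ i) ^ \<alpha> i))" for x :: "real^'d"
    using fin by (subst sum.remove[of _ "\<lambda>_. 0"]) (auto intro!: sum.neutral)
  then show ?thesis unfolding Pk_def by (intro CollectI exI[of _ ?c] ballI)
qed

text \<open>As \<open>g\<close> is continuous on the whole space, it is bounded on the compact
  closure of \<open>D\<close> even where \<open>D\<close> is not closed. The measure is left general
  to serve both Lebesgue measure on elements and surface measure on facets.\<close>

lemma set_integrable_bounded_continuous:
  fixes g :: "'a::euclidean_space \<Rightarrow> real"
  assumes sets: "sets M = sets borel" and D: "D \<in> sets borel" "bounded D" "emeasure M D < \<infinity>"
    and g: "continuous_on UNIV g" and fg: "\<And>x. x \<in> D \<Longrightarrow> f x = g x"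
  shows "set_integrable M D f"
proof -
  have "compact (closure D)" using D(2) by simp
  then have "bounded (g ` closure D)"
    using g by (intro compact_imp_bounded compact_continuous_image) (auto intro: continuous_on_subset)
  then obtain c where c: "\<And>x. x \<in> closure D \<Longrightarrow> \<bar>g x\<bar> \<le> c" unfolding bounded_iff by auto
  have "g \<in> borel_measurable M"
    using borel_measurable_continuous_onI[OF g] sets by (simp cong: measurable_cong_sets)
  then have "set_integrable M D g"
    unfolding set_integrable_def
    by (rule integrableI_bounded_set_indicator[rotated, where B = c])
      (use c D sets subsetD[OF closure_subset] in \<open>auto intro!: AE_I2\<close>)
  then show ?thesis
    unfolding set_integrable_def by (rule Bochner_Integration.integrable_cong[THEN iffD1, rotated 2])
      (auto simp: fg indicator_def)
qed

text \<open>The assumption \<open>pos\<close> says that the measure has full support on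
  \<open>D\<close>: a point with \<open>g x \<noteq> 0\<close> would have a relatively open
  neighbourhood of nonzero measure on which \<open>g\<close> does not vanish.\<close>

lemma continuous_AE_zero_imp_zero:
  fixes g :: "'a::euclidean_space \<Rightarrow> real"
  assumes sets: "sets M = sets borel" and D: "D \<in> sets borel"
    and pos: "\<And>V. open V \<Longrightarrow> V \<inter> D \<noteq> {} \<Longrightarrow> emeasure M (V \<inter> D) \<noteq> 0"
    and g: "continuous_on UNIV g" and AE: "AE x in M. x \<in> D \<longrightarrow> g x = 0" and x: "x \<in> D"
  shows "g x = 0"
proof (rule ccontr)
  assume nz: "g x \<noteq> 0"
  define V where "V = {y. g y \<noteq> 0}"
  have V: "open V"
    unfolding V_def using g by (intro open_Collect_neq) auto
  have "emeasure M (V \<inter> D) = 0"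
  proof (rule AE_iff_measurable[THEN iffD1, OF _ _ AE])
    have "space M = UNIV" using sets_eq_imp_space_eq[OF sets] by simp
    then show "{x \<in> space M. \<not> (x \<in> D \<longrightarrow> g x = 0)} = V \<inter> D" by (auto simp: V_def)
    show "V \<inter> D \<in> sets M" using V D sets by auto
  qed
  moreover have "V \<inter> D \<noteq> {}" using x nz by (auto simp: V_def)
  ultimately show False using pos V by blast
qed

text \<open>Integrability is a hypothesis because the integral of a non-integrable function is
  \<open>0\<close> by convention.\<close>

lemma set_integral_square_zero:
  fixes f :: "'a::euclidean_space \<Rightarrow> real"
  assumes int: "set_integrable M S (\<lambda>x. (f x)\<^sup>2)" and zero: "(LINT x:S|M. (f x)\<^sup>2) = 0"
  shows "AE x in M. x \<in> S \<longrightarrow> f x = 0"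
proof -
  have "AE x in M. indicat_real S x *\<^sub>R (f x)\<^sup>2 = 0"
    using int zero unfolding set_integrable_def set_lebesgue_integral_def
    by (subst integral_nonneg_eq_0_iff_AE[symmetric]) auto
  then show ?thesis by eventually_elim (auto simp: indicator_def)
qed

lemma emeasure_lborel_open_nonzero:
  fixes U :: "'a::euclidean_space set"
  assumes "open U" "U \<noteq> {}"
  shows "emeasure lborel U \<noteq> 0"
proof
  assume "emeasure lborel U = 0"
  then have "U \<in> null_sets lborel" using assms by auto
  then have "negligible U" by (simp add: negligible_iff_null_sets null_sets_completionI)
  with open_not_negligible assms show False by blast
qed

lemma facet_int_nonneg: "(\<And>x. g x \<ge> 0) \<Longrightarrow> facet_int F g \<ge> 0"
  unfolding facet_int_def set_lebesgue_integral_def by (intro Bochner_Integration.integral_nonneg) auto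

lemma elem_int_nonneg: "(\<And>x. g x \<ge> 0) \<Longrightarrow> elem_int K g \<ge> 0"
  unfolding elem_int_def set_lebesgue_integral_def by (intro Bochner_Integration.integral_nonneg) auto

section \<open>Surface measure on a facet\<close>

context
  fixes F :: "(real^'d) set"
  assumes F: "compact F" "convex F" "F \<noteq> {}"
begin

text \<open>The set to which \<open>facet_measure\<close> restricts Lebesgue measure before
  projecting, named so that its closedness and boundedness can be used.\<close>

definition prism :: "(real^'d) set" where
  "prism = {y. closest_point (affine hull F) y \<in> F \<and> dist y (closest_point (affine hull F) y) \<le> 1/2}"

lemma continuous_on_closest_point_hull: "continuous_on S (closest_point (affine hull F))"
  using F by (intro continuous_on_closest_point) (auto simp: affine_imp_convex closed_affine_hull)

lemma closed_prism: "closed prism"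
proof -
  have "closed (closest_point (affine hull F) -` F)"
    using F continuous_on_closest_point_hull by (intro closed_vimage compact_imp_closed)
  moreover have "closed {y. dist y (closest_point (affine hull F) y) \<le> 1/2}"
    by (intro closed_Collect_le continuous_intros continuous_on_closest_point_hull)
  moreover have "prism = (closest_point (affine hull F) -` F) \<inter> {y. dist y (closest_point (affine hull F) y) \<le> 1/2}"
    by (auto simp: prism_def)
  ultimately show ?thesis by auto
qed

lemma bounded_prism: "bounded prism"
proof -
  obtain b where b: "\<And>x. x \<in> F \<Longrightarrow> norm x \<le> b"
    using compact_imp_bounded[OF F(1)] unfolding bounded_iff by auto
  have "norm y \<le> b + 1/2" if "y \<in> prism" for y
    using that b[of "closest_point (affine hull F) y"]
      norm_triangle_sub[of y "closest_point (affine hull F) y"]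
    by (auto simp: prism_def dist_norm)
  then show ?thesis unfolding bounded_iff by blast
qed

lemma facet_measure_eq:
  "facet_measure F = distr (restrict_space lborel prism) borel (closest_point (affine hull F))"
  unfolding facet_measure_def prism_def Let_def ..

lemma measurable_closest_point_hull: "closest_point (affine hull F) \<in> measurable (restrict_space lborel prism) borel"
  using borel_measurable_continuous_onI[OF continuous_on_closest_point_hull]
  by (intro measurable_restrict_space1) simp

lemma emeasure_facet_measure:
  assumes "S \<in> sets borel"
  shows "emeasure (facet_measure F) S = emeasure lborel (closest_point (affine hull F) -` S \<inter> prism)"
  unfolding facet_measure_eq emeasure_distr[OF measurable_closest_point_hull assms]
  using closed_prism
  by (subst emeasure_restrict_space) (auto simp: space_restrict_space)

lemma emeasure_facet_measure_finite:
  assumes "S \<in> sets borel"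
  shows "emeasure (facet_measure F) S < \<infinity>"
  unfolding emeasure_facet_measure[OF assms]
  by (rule emeasure_bounded_finite) (use bounded_prism in auto)

lemma rel_interior_borel: "rel_interior F \<in> sets borel"
proof -
  obtain W where "open W" "rel_interior F = affine hull F \<inter> W"
    using openin_rel_interior[of F] unfolding openin_open by blast
  then show ?thesis by (auto simp: closed_affine_hull)
qed

text \<open>This is full support of the surface measure. The points that project into the relatively
  open piece from a distance below \<open>1/2\<close> form an open set inside the prism, and it is
  nonempty because the projection fixes the piece itself.\<close>

lemma emeasure_facet_measure_nonzero:
  assumes V: "open V" and ne: "V \<inter> rel_interior F \<noteq> {}"
  shows "emeasure (facet_measure F) (V \<inter> rel_interior F) \<noteq> 0"
proof -
  let ?p = "closest_point (affine hull F)"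
  obtain W where W: "open W" "rel_interior F = affine hull F \<inter> W"
    using openin_rel_interior[of F] unfolding openin_open by blast
  have p: "?p y \<in> affine hull F" for y
    using F by (intro closest_point_in_set) (auto simp: closed_affine_hull)
  let ?U = "?p -` (V \<inter> W) \<inter> {y. dist y (?p y) < 1/2}"
  have op: "open ?U"
  proof (rule open_Int)
    show "open (?p -` (V \<inter> W))" using V W(1) by (intro open_vimage continuous_on_closest_point_hull) auto
    show "open {y. dist y (?p y) < 1/2}"
      by (rule open_Collect_less[OF continuous_on_dist[OF continuous_on_id continuous_on_closest_point_hull] continuous_on_const])
  qed
  obtain x where x: "x \<in> V" "x \<in> rel_interior F" using ne by blast
  then have "?p x = x" using W by (intro closest_point_self) auto
  then have "x \<in> ?U" using x W by auto
  then have nz: "emeasure lborel ?U \<noteq> 0" by (intro emeasure_lborel_open_nonzero[OF op]) blast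
  note rb = rel_interior_borel
  have sub: "?U \<subseteq> ?p -` (V \<inter> rel_interior F) \<inter> prism"
    using p rel_interior_subset[of F] unfolding prism_def W(2) by auto
  have "?p -` (V \<inter> rel_interior F) \<in> sets borel"
    using borel_measurable_continuous_onI[OF continuous_on_closest_point_hull] V rb
    by (metis borel_open measurable_sets_borel sets.Int)
  then have "?p -` (V \<inter> rel_interior F) \<inter> prism \<in> sets lborel"
    using closed_prism by auto
  then have "emeasure lborel ?U \<le> emeasure lborel (?p -` (V \<inter> rel_interior F) \<inter> prism)"
    by (rule emeasure_mono[OF sub])
  with nz show ?thesis
    using V rb by (subst emeasure_facet_measure) auto
qed

text \<open>The measure is finite on the facet, so the square is integrable and \<open>f\<close>
  vanishes almost everywhere; full support and continuity of the polynomial remove the exceptional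
  set.\<close>

lemma facet_int_square_zero:
  assumes f: "f \<in> Pk k (rel_interior F)" and zero: "facet_int F (\<lambda>x. (f x)\<^sup>2) = 0"
    and x: "x \<in> rel_interior F"
  shows "f x = 0"
proof -
  obtain g where g: "continuous_on UNIV g" "\<And>x. x \<in> rel_interior F \<Longrightarrow> f x = g x"
    by (rule Pk_eq_continuous[OF f]) blast
  have sets: "sets (facet_measure F) = sets borel" unfolding facet_measure_eq by simp
  have "set_integrable (facet_measure F) (rel_interior F) (\<lambda>x. (f x)\<^sup>2)"
  proof (rule set_integrable_bounded_continuous[OF sets rel_interior_borel])
    show "bounded (rel_interior F)"
      by (rule bounded_subset[OF compact_imp_bounded[OF F(1)] rel_interior_subset])
    show "continuous_on UNIV (\<lambda>x. (g x)\<^sup>2)" by (intro continuous_on_power g)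
    show "emeasure (facet_measure F) (rel_interior F) < \<infinity>"
      by (rule emeasure_facet_measure_finite[OF rel_interior_borel])
    show "(f x)\<^sup>2 = (g x)\<^sup>2" if "x \<in> rel_interior F" for x using g(2)[OF that] by simp
  qed
  from set_integral_square_zero[OF this]
  have "AE x in facet_measure F. x \<in> rel_interior F \<longrightarrow> f x = 0"
    using zero by (simp add: facet_int_def)
  then have "AE x in facet_measure F. x \<in> rel_interior F \<longrightarrow> g x = 0"
    by eventually_elim (use g in auto)
  from continuous_AE_zero_imp_zero[OF sets rel_interior_borel emeasure_facet_measure_nonzero g(1) this x]
  show ?thesis using g x by simp
qed

end

section \<open>Mesh geometry and the discrete spaces with their norms\<close>

context
  fixes \<Omega> :: "(real^'d) set" and T :: "(real^'d) set set"
  assumes mesh: "simplicial_mesh \<Omega> T"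
begin

lemma finite_mesh: "finite T"
  using mesh unfolding simplicial_mesh_def triangulation_def by blast

lemma mesh_nonempty: "T \<noteq> {}"
  using mesh closure_subset[of \<Omega>] unfolding simplicial_mesh_def by fastforce

lemma mesh_element:
  assumes "K \<in> T"
  shows "polytope K" "compact K" "convex K" "aff_dim K = int CARD('d)" "interior K \<noteq> {}"
    "interior K \<subseteq> \<Omega>"
proof -
  have K: "int CARD('d) simplex K" using mesh assms unfolding simplicial_mesh_def by blast
  show p: "polytope K" using K by (rule simplex_imp_polytope)
  show "compact K" "convex K" using p by (auto simp: polytope_imp_compact polytope_imp_convex)
  show d: "aff_dim K = int CARD('d)" using K by (rule aff_dim_simplex)
  \<comment> \<open>In full dimension the interior is the relative interior, which is nonempty for a
    nonempty convex set; \<open>K\<close> is nonempty since the empty set has affine dimension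
    \<open>-1\<close>.\<close>
  show "interior K \<noteq> {}"
    using d \<open>convex K\<close> by (metis DIM_cart DIM_real aff_dim_empty interior_rel_interior_gen
        mult.right_neutral of_nat_0_le_iff neg_0_le_iff_le not_one_le_zero rel_interior_eq_empty)
  show "interior K \<subseteq> \<Omega>" using mesh assms unfolding simplicial_mesh_def by blast
qed

lemma finite_facets: "finite (facets T)"
proof -
  have "facets T = (\<Union>K\<in>T. {F. F facet_of K})" by (auto simp: facets_def)
  then show ?thesis using finite_mesh mesh_element(1) finite_polytope_facets by auto
qed

lemma mesh_facet:
  assumes "F \<in> facets T"
  shows "compact F" "convex F" "F \<noteq> {}" "aff_dim F = int CARD('d) - 1"
proof -
  obtain K where K: "K \<in> T" "F facet_of K" using assms by (auto simp: facets_def)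
  then have face: "F face_of K" and ne: "F \<noteq> {}" and dim: "aff_dim F = aff_dim K - 1"
    by (auto simp: facet_of_def)
  show "compact F" using face_of_imp_compact[OF mesh_element(3,2) face] K(1) by blast
  show "convex F" using face by (rule face_of_imp_convex)
  show "F \<noteq> {}" "aff_dim F = int CARD('d) - 1" using ne dim mesh_element(4)[OF K(1)] by auto
qed

lemma facet_size_nonneg: "F \<in> facets T \<Longrightarrow> facet_size F \<ge> 0"
  unfolding facet_size_def using mesh_facet(1) by (intro diameter_ge_0 compact_imp_bounded)

text \<open>A facet has dimension \<open>d - 1\<close>, here at least 1, so it contains two distinct
  points; on the line facets would be single points of diameter \<open>0\<close>.\<close>

lemma facet_size_pos:
  assumes "CARD('d) \<ge> 2" "F \<in> facets T"
  shows "facet_size F > 0"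
proof -
  obtain a where a: "a \<in> F" using mesh_facet(3)[OF assms(2)] by blast
  have "F \<noteq> {a}" using mesh_facet(4)[OF assms(2)] assms(1) by auto
  then obtain b where b: "b \<in> F" "b \<noteq> a" using a by blast
  have "dist a b \<le> facet_size F"
    unfolding facet_size_def using mesh_facet(1)[OF assms(2)] a b
    by (intro diameter_bounded_bound compact_imp_bounded)
  moreover have "dist a b > 0" using b by simp
  ultimately show ?thesis by linarith
qed

text \<open>The chosen representative vanishes off the open elements, so integrals over
  \<open>\<Omega>\<close> reduce to a finite union of bounded open sets, on each of which
  \<open>q\<close> is a polynomial.\<close>

lemma set_integrable_broken:
  assumes "\<And>K. K \<in> T \<Longrightarrow> q \<in> Pk m (interior K)" "\<And>x. x \<notin> (\<Union>K\<in>T. interior K) \<Longrightarrow> q x = 0"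
  shows "set_integrable lborel \<Omega> q" "set_integrable lborel \<Omega> (\<lambda>x. (q x)\<^sup>2)"
proof -
  let ?U = "\<Union>K\<in>T. interior K"
  have loc: "set_integrable lborel (interior K) q \<and> set_integrable lborel (interior K) (\<lambda>x. (q x)\<^sup>2)"
    if K: "K \<in> T" for K
  proof -
    obtain g where g: "continuous_on UNIV g" "\<And>x. x \<in> interior K \<Longrightarrow> q x = g x"
      by (rule Pk_eq_continuous[OF assms(1)[OF K]]) blast
    have b: "bounded (interior K)"
      using mesh_element(2)[OF K] by (simp add: bounded_interior compact_imp_bounded)
    have g2: "continuous_on UNIV (\<lambda>x. (g x)\<^sup>2)" by (intro continuous_intros g)
    show ?thesis
      using set_integrable_bounded_continuous[OF sets_lborel _ b emeasure_bounded_finite[OF b] g]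
        set_integrable_bounded_continuous[OF sets_lborel _ b emeasure_bounded_finite[OF b] g2, of "\<lambda>x. (q x)\<^sup>2"]
        g(2) by auto
  qed
  have "?U \<subseteq> \<Omega>" using mesh_element(6) by blast
  then have eq: "indicat_real \<Omega> x *\<^sub>R q x = indicat_real ?U x *\<^sub>R q x"
    "indicat_real \<Omega> x *\<^sub>R (q x)\<^sup>2 = indicat_real ?U x *\<^sub>R (q x)\<^sup>2" for x
    using assms(2)[of x] by (cases "x \<in> ?U"; auto simp: indicator_def)+
  have "set_integrable lborel ?U q" "set_integrable lborel ?U (\<lambda>x. (q x)\<^sup>2)"
    using finite_mesh loc by (auto intro!: set_integrable_UN)
  then show "set_integrable lborel \<Omega> q" "set_integrable lborel \<Omega> (\<lambda>x. (q x)\<^sup>2)"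
    unfolding set_integrable_def eq by auto
qed

text \<open>On each open element, continuity of the polynomial turns zero almost everywhere into
  zero; elsewhere the representative is zero by its choice. This makes \<open>Q\<close>
  definite.\<close>

lemma norm_L2_zero:
  assumes q: "q \<in> Q_space \<Omega> T m" and zero: "norm_L2 \<Omega> q = 0"
  shows "q = (\<lambda>_. 0)"
proof
  fix x
  have int: "set_integrable lborel \<Omega> (\<lambda>x. (q x)\<^sup>2)"
    by (rule set_integrable_broken) (use q in \<open>auto simp: Q_space_def\<close>)
  have "(LINT x:\<Omega>|lborel. (q x)\<^sup>2) = 0" using zero by (simp add: norm_L2_def)
  from set_integral_square_zero[OF int this] have AE: "AE x in lborel. x \<in> \<Omega> \<longrightarrow> q x = 0" .
  show "q x = 0"
  proof (cases "x \<in> (\<Union>K\<in>T. interior K)")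
    case True
    then obtain K where K: "K \<in> T" "x \<in> interior K" by blast
    then obtain g where g: "continuous_on UNIV g" "\<And>x. x \<in> interior K \<Longrightarrow> q x = g x"
      using q Pk_eq_continuous[of q m "interior K"] unfolding Q_space_def by blast
    have AEg: "AE x in lborel. x \<in> interior K \<longrightarrow> g x = 0"
      using AE by eventually_elim (use g mesh_element(6)[OF K(1)] in auto)
    have "g x = 0"
      by (rule continuous_AE_zero_imp_zero[OF sets_lborel _ _ g(1) AEg K(2)])
        (auto dest!: emeasure_lborel_open_nonzero[OF open_Int[OF _ open_interior]])
    then show ?thesis using g K by simp
  qed (use q in \<open>auto simp: Q_space_def\<close>)
qed

text \<open>All facet terms are nonnegative, so each vanishes, and the positive weight
  \<open>facet_size F\<close> can be cancelled before arguing facet by facet. This makes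
  \<open>M\<close> definite.\<close>

lemma norm_lam_zero:
  assumes d: "CARD('d) \<ge> 2" and xi: "\<xi> \<in> M_space T k" and zero: "norm_lam T \<xi> = 0"
  shows "\<xi> = (\<lambda>_. 0)"
proof
  fix x
  have nn: "facet_size F * facet_int F (\<lambda>x. (\<xi> x)\<^sup>2) \<ge> 0" if "F \<in> facets T" for F
    using facet_size_nonneg[OF that] by (intro mult_nonneg_nonneg facet_int_nonneg) auto
  have "(\<Sum>F\<in>facets T. facet_size F * facet_int F (\<lambda>x. (\<xi> x)\<^sup>2)) = 0"
    using zero by (simp add: norm_lam_def)
  then have "\<forall>F\<in>facets T. facet_size F * facet_int F (\<lambda>x. (\<xi> x)\<^sup>2) = 0"
    using sum_nonneg_eq_0_iff[OF finite_facets nn] by simp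
  then have z: "facet_int F (\<lambda>x. (\<xi> x)\<^sup>2) = 0" if "F \<in> facets T" for F
    using that facet_size_pos[OF d that] by auto
  show "\<xi> x = 0"
  proof (cases "x \<in> (\<Union>F\<in>facets T. rel_interior F)")
    case True
    then obtain F where F: "F \<in> facets T" "x \<in> rel_interior F" by blast
    show ?thesis
      by (rule facet_int_square_zero[OF mesh_facet(1-3)[OF F(1)] _ z[OF F(1)] F(2)])
        (use xi F in \<open>auto simp: M_space_def\<close>)
  qed (use xi in \<open>auto simp: M_space_def\<close>)
qed

lemma norm_1h_nonneg: "norm_1h T P v \<ge> 0"
  unfolding norm_1h_def
  by (intro real_sqrt_ge_zero add_nonneg_nonneg sum_nonneg elem_int_nonneg facet_int_nonneg
      mult_nonneg_nonneg) (auto simp: facet_size_nonneg)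

text \<open>The supremum in the inf-sup condition must range over a nonempty set to be bounded by a
  bound on its members. The witness is the all-ones vector field on the open elements.\<close>

lemma V_space_nontrivial: "V_space T k - {\<lambda>_. 0} \<noteq> {}"
proof -
  let ?U = "\<Union>K\<in>T. interior K"
  define v :: "real^'d \<Rightarrow> real^'d" where "v = (\<lambda>x. if x \<in> ?U then 1 else 0)"
  have "(\<lambda>x. v x $ i) \<in> Pk k (interior K)" if "K \<in> T" for K i
    using Pk_const[of 1 k "interior K"] that unfolding Pk_def v_def by auto
  then have "v \<in> V_space T k" unfolding V_space_def v_def by auto
  moreover obtain x where "x \<in> ?U" using mesh_nonempty mesh_element(5) by blast
  then have "v x \<noteq> 0" by (simp add: v_def)
  ultimately show ?thesis by auto
qed

lemma lin_comb_V_space: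
  assumes "\<And>j. j < n \<Longrightarrow> \<phi> j \<in> V_space T k"
  shows "lin_comb n \<phi> c \<in> V_space T k"
  using assms Pk_sum[of n "\<lambda>j x. \<phi> j x $ i" k "interior K" "vec_index c" for i K]
  unfolding V_space_def lin_comb_def by simp

lemma lin_comb_M_space:
  assumes "\<And>j. j < n \<Longrightarrow> \<theta> j \<in> M_space T k"
  shows "lin_comb n \<theta> c \<in> M_space T k"
  using assms Pk_sum[of n \<theta> k "rel_interior F" "vec_index c" for F]
  unfolding M_space_def lin_comb_def by simp

text \<open>The zero-mean condition is the delicate part: exchanging sum and integral uses the
  integrability of every \<open>\<psi> j\<close>.\<close>

lemma lin_comb_Q_space:
  assumes "\<And>j. j < n \<Longrightarrow> \<psi> j \<in> Q_space \<Omega> T m"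
  shows "lin_comb n \<psi> c \<in> Q_space \<Omega> T m"
proof -
  have int: "set_integrable lborel \<Omega> (\<psi> j)" if "j < n" for j
    using assms[OF that] unfolding Q_space_def by (intro set_integrable_broken(1)) blast+
  have "(LINT x:\<Omega>|lborel. \<Sum>j<n. vec_index c j * \<psi> j x) =
      (\<Sum>j<n. vec_index c j * (LINT x:\<Omega>|lborel. \<psi> j x))"
  proof -
    have "(LINT x:\<Omega>|lborel. \<Sum>j<n. vec_index c j * \<psi> j x) =
        integral\<^sup>L lborel (\<lambda>x. \<Sum>j<n. vec_index c j * (indicat_real \<Omega> x *\<^sub>R \<psi> j x))"
      unfolding set_lebesgue_integral_def by (simp add: sum_distrib_left mult_ac)
    also have "\<dots> = (\<Sum>j<n. integral\<^sup>L lborel (\<lambda>x. vec_index c j * (indicat_real \<Omega> x *\<^sub>R \<psi> j x)))"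
      using int unfolding set_integrable_def
      by (intro Bochner_Integration.integral_sum integrable_mult_right) auto
    finally show ?thesis unfolding set_lebesgue_integral_def by simp
  qed
  also have "\<dots> = 0" using assms by (simp add: Q_space_def)
  finally show ?thesis
    using assms Pk_sum[of n \<psi> m "interior K" "vec_index c" for K]
    unfolding Q_space_def lin_comb_def by simp
qed

end

text \<open>The element part sees only \<open>q\<close> and the facet part only
  \<open>\<xi>\<close>, so no integral has to be split and no integrability is involved. It joins
  the separately assembled \<open>B\<close> and \<open>C\<close>.\<close>

lemma b_form_split: "b_form T P (q, \<xi>) v = b_form T P (q, \<lambda>_. 0) v + b_form T P (\<lambda>_. 0, \<xi>) v"
  by (simp add: b_form_def elem_int_def facet_int_def)

section \<open>Transfer from the discrete spaces to the matrices, uniformly in the mesh\<close>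

theorem corollary1:
  fixes \<Omega> :: "(real^'d) set"
    and H :: "real set"
    and T :: "real \<Rightarrow> (real^'d) set set"
    and P :: "real \<Rightarrow> (real^'d) set \<Rightarrow> (real^'d) set"
    and k :: nat
    and \<eta> \<alpha> c_a c_b \<beta> \<beta>_lam c_i :: real
    and n_u n_p n_l :: "real \<Rightarrow> nat"
    and \<phi> :: "real \<Rightarrow> nat \<Rightarrow> real^'d \<Rightarrow> real^'d"
    and \<psi> \<theta> :: "real \<Rightarrow> nat \<Rightarrow> real^'d \<Rightarrow> real"
    and A B C Q M At :: "real \<Rightarrow> real mat"
  assumes k: "k \<ge> 1" and d: "CARD('d) \<in> {2, 3}"
    and mesh: "\<And>h. h \<in> H \<Longrightarrow> simplicial_mesh \<Omega> (T h)"
    and size: "\<And>h. h \<in> H \<Longrightarrow> mesh_size (T h) = h"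
    and plus: "\<And>h. h \<in> H \<Longrightarrow> plus_choice (T h) (P h)"
    and constants: "\<eta> > 0" "\<alpha> > 0" "c_a > 0" "c_b > 0" "\<beta> > 0" "\<beta>_lam > 0" "c_i > 0"
    and a_coercive: "\<And>h v. h \<in> H \<Longrightarrow> v \<in> V_space (T h) k \<Longrightarrow>
          a_form (T h) (P h) \<eta> v v \<ge> \<alpha> * (norm_1h (T h) (P h) v)\<^sup>2"
    and a_bounded: "\<And>h u v. h \<in> H \<Longrightarrow> u \<in> V_space (T h) k \<Longrightarrow> v \<in> V_space (T h) k \<Longrightarrow>
          \<bar>a_form (T h) (P h) \<eta> u v\<bar> \<le> c_a * norm_1h (T h) (P h) u * norm_1h (T h) (P h) v"
    and b_bounded: "\<And>h q \<xi> v. h \<in> H \<Longrightarrow> q \<in> Q_space \<Omega> (T h) (k - 1) \<Longrightarrow>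
          \<xi> \<in> M_space (T h) k \<Longrightarrow> v \<in> V_space (T h) k \<Longrightarrow>
          \<bar>b_form (T h) (P h) (q, \<xi>) v\<bar>
            \<le> c_b * norm_1h (T h) (P h) v * sqrt ((norm_L2 \<Omega> q)\<^sup>2 + (norm_lam (T h) \<xi>)\<^sup>2)"
    and inf_sup: "\<And>h q \<xi>. h \<in> H \<Longrightarrow> q \<in> Q_space \<Omega> (T h) (k - 1) \<Longrightarrow> \<xi> \<in> M_space (T h) k \<Longrightarrow>
          c_i * sqrt (\<beta>\<^sup>2 * (norm_L2 \<Omega> q)\<^sup>2 + \<beta>_lam\<^sup>2 * (norm_lam (T h) \<xi>)\<^sup>2)
            \<le> (SUP w \<in> V_space (T h) k - {\<lambda>_. 0}.
                 b_form (T h) (P h) (q, \<xi>) w / norm_1h (T h) (P h) w)"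
    and basis_V: "\<And>h. h \<in> H \<Longrightarrow> is_basis (V_space (T h) k) (n_u h) (\<phi> h)"
    and basis_Q: "\<And>h. h \<in> H \<Longrightarrow> is_basis (Q_space \<Omega> (T h) (k - 1)) (n_p h) (\<psi> h)"
    and basis_M: "\<And>h. h \<in> H \<Longrightarrow> is_basis (M_space (T h) k) (n_l h) (\<theta> h)"
    and sym: "\<And>h. h \<in> H \<Longrightarrow> sym_mat (n_u h) (A h) \<and> sym_mat (n_p h) (Q h) \<and> sym_mat (n_l h) (M h)"
    and dims: "\<And>h. h \<in> H \<Longrightarrow> B h \<in> carrier_mat (n_p h) (n_u h) \<and> C h \<in> carrier_mat (n_l h) (n_u h)"
    and mat_A: "\<And>h v. h \<in> H \<Longrightarrow> v \<in> carrier_vec (n_u h) \<Longrightarrow>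
          a_form (T h) (P h) \<eta> (lin_comb (n_u h) (\<phi> h) v) (lin_comb (n_u h) (\<phi> h) v)
            = bilin v (A h) v"
    and mat_B: "\<And>h q v. h \<in> H \<Longrightarrow> q \<in> carrier_vec (n_p h) \<Longrightarrow> v \<in> carrier_vec (n_u h) \<Longrightarrow>
          b_form (T h) (P h) (lin_comb (n_p h) (\<psi> h) q, \<lambda>_. 0) (lin_comb (n_u h) (\<phi> h) v)
            = bilin q (B h) v"
    and mat_C: "\<And>h \<xi> v. h \<in> H \<Longrightarrow> \<xi> \<in> carrier_vec (n_l h) \<Longrightarrow> v \<in> carrier_vec (n_u h) \<Longrightarrow>
          b_form (T h) (P h) (\<lambda>_. 0, lin_comb (n_l h) (\<theta> h) \<xi>) (lin_comb (n_u h) (\<phi> h) v)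
            = bilin \<xi> (C h) v"
    and mat_Q: "\<And>h q. h \<in> H \<Longrightarrow> q \<in> carrier_vec (n_p h) \<Longrightarrow>
          (norm_L2 \<Omega> (lin_comb (n_p h) (\<psi> h) q))\<^sup>2 = bilin q (Q h) q"
    and mat_M: "\<And>h \<xi>. h \<in> H \<Longrightarrow> \<xi> \<in> carrier_vec (n_l h) \<Longrightarrow>
          (norm_lam (T h) (lin_comb (n_l h) (\<theta> h) \<xi>))\<^sup>2 = bilin \<xi> (M h) \<xi>"
    and spec_equiv: "spectrally_equivalent H n_u At A"
  shows "\<exists>c1>0. \<exists>c2>0. \<exists>c3>0. \<exists>c4>0. \<forall>h\<in>H.
           let AA = saddle_mat (A h) (B h) (C h);
               PP = diag_block_mat [At h, Q h, M h]
           in invertible_mat PP \<and>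
              (\<forall>\<rho>. eigenvalue (map_mat complex_of_real (the (mat_inverse PP) * AA)) \<rho> \<longrightarrow>
                   \<rho> \<in> complex_of_real ` ({- c1 .. - c2} \<union> {c3 .. c4}))"
proof -
  obtain \<delta> \<Delta> where \<delta>: "\<delta> > 0" and \<Delta>: "\<Delta> > 0"
    and equiv: "\<And>h v. h \<in> H \<Longrightarrow> v \<in> carrier_vec (n_u h) \<Longrightarrow>
        \<delta> * bilin v (At h) v \<le> bilin v (A h) v \<and> bilin v (A h) v \<le> \<Delta> * bilin v (At h) v"
    and At: "\<And>h. h \<in> H \<Longrightarrow> spd_mat (n_u h) (At h)"
    using spec_equiv unfolding spectrally_equivalent_def by blast
  \<comment> \<open>These are squared constants of \<open>b_h\<close> in the energy norm of
    \<open>A\<close>: coercivity costs \<open>1 / \<alpha>\<close> in the upper bound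
    \<open>\<kappa>\<close>, boundedness of \<open>a_h\<close> costs \<open>1 / c_a\<close> in the
    inf-sup constant \<open>g\<close>, and \<open>\<gamma>\<close> keeps the smaller inf-sup weight.
    All are fixed before \<open>h\<close>, hence independent of it.\<close>
  define \<kappa> where "\<kappa> = c_b\<^sup>2 / \<alpha>"
  define \<gamma> where "\<gamma> = min (\<beta>\<^sup>2) (\<beta>_lam\<^sup>2)"
  define g where "g = c_i\<^sup>2 * \<gamma> / c_a"
  define c where "c = \<Delta> + 1 + \<kappa> * \<Delta>"
  have \<kappa>: "\<kappa> > 0" and \<gamma>: "\<gamma> > 0" using constants by (auto simp: \<kappa>_def \<gamma>_def)
  then have g: "g > 0" using constants by (simp add: g_def)
  have c: "c > 0" using \<kappa> \<Delta> by (simp add: c_def add_pos_pos)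
  have card: "CARD('d) \<ge> 2" using d by auto
  have main: "invertible_mat (diag_block_mat [At h, Q h, M h]) \<and>
      (\<forall>\<rho>. eigenvalue (map_mat complex_of_real
          (the (mat_inverse (diag_block_mat [At h, Q h, M h])) * saddle_mat (A h) (B h) (C h))) \<rho> \<longrightarrow>
        \<rho> \<in> complex_of_real ` ({- c .. - min \<delta> (g / 2)} \<union> {\<delta> .. c}))"
    if h: "h \<in> H" for h
  proof -
    define n where "n = n_u h"
    define m where "m = n_p h"
    define l where "l = n_l h"
    define u where "u = lin_comb n (\<phi> h)"
    define p where "p = lin_comb m (\<psi> h)"
    define s where "s = lin_comb l (\<theta> h)"
    define N where "N = (\<lambda>v. norm_1h (T h) (P h) (u v))"
    define D where "D = B h @\<^sub>r C h"
    define S where "S = four_block_mat (Q h) (0\<^sub>m m l) (0\<^sub>m l m) (M h)"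
    note T = mesh[OF h]
    have As: "sym_mat n (A h)" and Qs: "sym_mat m (Q h)" and Ms: "sym_mat l (M h)"
      using sym[OF h] by (auto simp: n_def m_def l_def)
    have Ac: "A h \<in> carrier_mat n n" and Qc: "Q h \<in> carrier_mat m m" and Mc: "M h \<in> carrier_mat l l"
      using As Qs Ms by (auto simp: sym_mat_def)
    have Bc: "B h \<in> carrier_mat m n" and Cc: "C h \<in> carrier_mat l n"
      using dims[OF h] by (auto simp: n_def m_def l_def)
    have Dc: "D \<in> carrier_mat (m + l) n" using Bc Cc by (simp add: D_def)
    have Ath: "spd_mat n (At h)" using At[OF h] by (simp add: n_def)
    then have Atc: "At h \<in> carrier_mat n n" by (simp add: spd_mat_def sym_mat_def)
    have u: "u v \<in> V_space (T h) k" for v :: "real Matrix.vec"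
      unfolding u_def by (rule lin_comb_V_space[OF T])
        (use basis_V[OF h] in \<open>auto simp: is_basis_def n_def\<close>)
    have p: "p q \<in> Q_space \<Omega> (T h) (k - 1)" for q :: "real Matrix.vec"
      unfolding p_def by (rule lin_comb_Q_space[OF T])
        (use basis_Q[OF h] in \<open>auto simp: is_basis_def m_def\<close>)
    have s: "s \<xi> \<in> M_space (T h) k" for \<xi> :: "real Matrix.vec"
      unfolding s_def by (rule lin_comb_M_space[OF T])
        (use basis_M[OF h] in \<open>auto simp: is_basis_def l_def\<close>)
    have Qn: "(norm_L2 \<Omega> (p q))\<^sup>2 = bilin q (Q h) q" if "q \<in> carrier_vec m" for q :: "real Matrix.vec"
      using mat_Q[OF h, of q] that by (simp add: p_def m_def)
    have Mn: "(norm_lam (T h) (s \<xi>))\<^sup>2 = bilin \<xi> (M h) \<xi>" if "\<xi> \<in> carrier_vec l" for \<xi> :: "real Matrix.vec"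
      using mat_M[OF h, of \<xi>] that by (simp add: s_def l_def)
    \<comment> \<open>Linear independence of the basis gives a nonzero function for nonzero
      coefficients, and the norm is definite on the discrete space; likewise for \<open>M\<close>
      below.\<close>
    have Q: "spd_mat m (Q h)"
      unfolding spd_mat_def
    proof (intro conjI Qs ballI impI)
      fix q :: "real Matrix.vec" assume q: "q \<in> carrier_vec m" "q \<noteq> 0\<^sub>v m"
      then have "p q \<noteq> (\<lambda>_. 0)"
        using basis_Q[OF h] unfolding is_basis_def p_def m_def by blast
      then have "norm_L2 \<Omega> (p q) \<noteq> 0" using norm_L2_zero[OF T p] by blast
      then show "0 < bilin q (Q h) q" using Qn[OF q(1)] by (metis zero_less_power2)
    qed
    have M: "spd_mat l (M h)"
      unfolding spd_mat_def
    proof (intro conjI Ms ballI impI)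
      fix \<xi> :: "real Matrix.vec" assume \<xi>: "\<xi> \<in> carrier_vec l" "\<xi> \<noteq> 0\<^sub>v l"
      then have "s \<xi> \<noteq> (\<lambda>_. 0)"
        using basis_M[OF h] unfolding is_basis_def s_def l_def by blast
      then have "norm_lam (T h) (s \<xi>) \<noteq> 0" using norm_lam_zero[OF T card s] by blast
      then show "0 < bilin \<xi> (M h) \<xi>" using Mn[OF \<xi>(1)] by (metis zero_less_power2)
    qed
    have S: "spd_mat (m + l) S" unfolding S_def by (rule spd_four_block_mat(1)[OF Q M])
    then have Sc: "S \<in> carrier_mat (m + l) (m + l)" by (simp add: spd_mat_def sym_mat_def)
    have PP: "diag_block_mat [At h, Q h, M h] =
        four_block_mat (At h) (0\<^sub>m n (m + l)) (0\<^sub>m (m + l) n) S" (is "_ = ?PP")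
      unfolding S_def by (rule diag_block_mat_three[OF Atc Qc Mc])
    have PPs: "spd_mat (n + (m + l)) ?PP" by (rule spd_four_block_mat(1)[OF Ath S])
    have N0: "N v \<ge> 0" for v unfolding N_def by (rule norm_1h_nonneg[OF T])
    have NA: "\<alpha> * (N v)\<^sup>2 \<le> bilin v (A h) v" "bilin v (A h) v \<le> c_a * (N v)\<^sup>2"
      if "v \<in> carrier_vec n" for v :: "real Matrix.vec"
    proof -
      have "a_form (T h) (P h) \<eta> (u v) (u v) = bilin v (A h) v"
        using mat_A[OF h, of v] that by (simp add: u_def n_def)
      then show "\<alpha> * (N v)\<^sup>2 \<le> bilin v (A h) v" "bilin v (A h) v \<le> c_a * (N v)\<^sup>2"
        using a_coercive[OF h u, of v] a_bounded[OF h u u, of v v]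
        by (auto simp: N_def power2_eq_square mult.assoc)
    qed
    have split: "\<exists>q\<in>carrier_vec m. \<exists>\<xi>\<in>carrier_vec l. y = q @\<^sub>v \<xi>"
      if "y \<in> carrier_vec (m + l)" for y :: "real Matrix.vec"
      using vec_first_last_append[OF that] by (metis vec_first_carrier vec_last_carrier)
    have bD: "b_form (T h) (P h) (p q, s \<xi>) (u v) = bilin (q @\<^sub>v \<xi>) D v"
      if "q \<in> carrier_vec m" "\<xi> \<in> carrier_vec l" "v \<in> carrier_vec n" for q \<xi> v :: "real Matrix.vec"
      unfolding D_def bilin_append_rows[OF Bc Cc that]
      using mat_B[OF h, of q v] mat_C[OF h, of \<xi> v] that
      by (subst b_form_split) (simp add: p_def s_def u_def n_def m_def l_def)
    have Sn: "(norm_L2 \<Omega> (p q))\<^sup>2 + (norm_lam (T h) (s \<xi>))\<^sup>2 = bilin (q @\<^sub>v \<xi>) S (q @\<^sub>v \<xi>)"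
      if "q \<in> carrier_vec m" "\<xi> \<in> carrier_vec l" for q \<xi> :: "real Matrix.vec"
      unfolding S_def spd_four_block_mat(2)[OF Q M that that] Qn[OF that(1)] Mn[OF that(2)] ..
    have bounded: "(bilin y D v)\<^sup>2 \<le> \<kappa> * bilin v (A h) v * bilin y S y"
      if y: "y \<in> carrier_vec (m + l)" and v: "v \<in> carrier_vec n" for y v :: "real Matrix.vec"
    proof -
      obtain q \<xi> where q: "q \<in> carrier_vec m" and \<xi>: "\<xi> \<in> carrier_vec l" and yq: "y = q @\<^sub>v \<xi>"
        using split[OF y] by blast
      have Sy: "bilin y S y \<ge> 0" by (rule spd_mat_nonneg[OF S y])
      have "\<bar>bilin y D v\<bar> \<le> c_b * N v * sqrt (bilin y S y)"
        using b_bounded[OF h p s u, of q \<xi> v] unfolding bD[OF q \<xi> v] Sn[OF q \<xi>] N_def yq .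
      then have "(bilin y D v)\<^sup>2 \<le> (c_b * N v * sqrt (bilin y S y))\<^sup>2"
        using power_mono[of "\<bar>bilin y D v\<bar>" _ 2] by simp
      also have "\<dots> = \<kappa> * (\<alpha> * (N v)\<^sup>2) * bilin y S y"
        using Sy constants by (simp add: power_mult_distrib \<kappa>_def)
      also have "\<dots> \<le> \<kappa> * bilin v (A h) v * bilin y S y"
        using NA(1)[OF v] \<kappa> Sy by (intro mult_right_mono mult_left_mono) auto
      finally show ?thesis .
    qed
    have infsup: "g * bilin y S y \<le> K"
      if y: "y \<in> carrier_vec (m + l)" and K: "K \<ge> 0"
        and le: "\<And>w. w \<in> carrier_vec n \<Longrightarrow> (bilin y D w)\<^sup>2 \<le> K * bilin w (A h) w"
      for K and y :: "real Matrix.vec"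
    proof -
      obtain q \<xi> where q: "q \<in> carrier_vec m" and \<xi>: "\<xi> \<in> carrier_vec l" and yq: "y = q @\<^sub>v \<xi>"
        using split[OF y] by blast
      \<comment> \<open>The bound \<open>le\<close> is in the energy norm; boundedness of
        \<open>a_h\<close> converts it to the mesh norm, at the price of the factor
        \<open>c_a\<close>, for every quotient under the supremum.\<close>
      have "(SUP w \<in> V_space (T h) k - {\<lambda>_. 0}.
          b_form (T h) (P h) (p q, s \<xi>) w / norm_1h (T h) (P h) w) \<le> sqrt (K * c_a)"
      proof (rule cSUP_least[OF V_space_nontrivial[OF T]])
        fix W assume "W \<in> V_space (T h) k - {\<lambda>_. 0}"
        then obtain w where w: "w \<in> carrier_vec n" "W = u w"
          using basis_V[OF h] unfolding is_basis_def u_def n_def by blast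
        have "(bilin y D w)\<^sup>2 \<le> K * (c_a * (N w)\<^sup>2)"
          using le[OF w(1)] mult_left_mono[OF NA(2)[OF w(1)] K] by linarith
        then have "sqrt ((bilin y D w)\<^sup>2) \<le> sqrt (K * c_a * (N w)\<^sup>2)"
          by (simp only: real_sqrt_le_iff mult.assoc)
        then have "bilin y D w \<le> sqrt (K * c_a) * N w"
          using N0[of w] by (simp add: real_sqrt_mult)
        \<comment> \<open>If \<open>N w = 0\<close>, the quotient is \<open>0\<close> by the
          convention for division, which the nonnegative right side still bounds.\<close>
        then have "bilin y D w / N w \<le> sqrt (K * c_a)"
          using N0[of w] K constants by (cases "N w = 0") (auto simp: divide_le_eq)
        then show "b_form (T h) (P h) (p q, s \<xi>) W / norm_1h (T h) (P h) W \<le> sqrt (K * c_a)"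
          unfolding w(2) bD[OF q \<xi> w(1)] N_def yq .
      qed
      then have le': "c_i * sqrt (\<beta>\<^sup>2 * (norm_L2 \<Omega> (p q))\<^sup>2 + \<beta>_lam\<^sup>2 * (norm_lam (T h) (s \<xi>))\<^sup>2)
          \<le> sqrt (K * c_a)" (is "c_i * sqrt ?R \<le> _")
        using inf_sup[OF h p s, of q \<xi>] by linarith
      have R: "?R \<ge> 0" by simp
      have "(c_i * sqrt ?R)\<^sup>2 \<le> (sqrt (K * c_a))\<^sup>2"
        by (rule power_mono[OF le']) (use constants R in simp)
      then have "c_i\<^sup>2 * ?R \<le> K * c_a"
        using R K constants by (simp add: power_mult_distrib)
      moreover have "\<gamma> * bilin y S y \<le> ?R"
        unfolding yq Sn[OF q \<xi>, symmetric] distrib_left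
        by (intro add_mono mult_right_mono) (auto simp: \<gamma>_def)
      then have "c_i\<^sup>2 * (\<gamma> * bilin y S y) \<le> c_i\<^sup>2 * ?R" by (rule mult_left_mono) simp
      ultimately have "c_i\<^sup>2 * (\<gamma> * bilin y S y) \<le> K * c_a" by linarith
      then show ?thesis using constants by (simp add: g_def field_simps)
    qed
    have "\<rho> \<in> complex_of_real ` ({- c .. - min \<delta> (g / 2)} \<union> {\<delta> .. c})"
      if ev: "eigenvalue (map_mat complex_of_real (the (mat_inverse ?PP) * saddle_mat (A h) (B h) (C h))) \<rho>"
      for \<rho>
    proof -
      obtain r x where \<rho>: "\<rho> = complex_of_real r" and x: "x \<in> carrier_vec (n + (m + l))"
        and nz: "x \<noteq> 0\<^sub>v (n + (m + l))"
        and eq: "saddle_mat (A h) (B h) (C h) *\<^sub>v x = r \<cdot>\<^sub>v (?PP *\<^sub>v x)"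
        by (rule symmetric_pencil_eigenvalue_real[OF sym_saddle_mat[OF As Bc Cc] PPs ev])
      define v where "v = vec_first x n"
      define y where "y = vec_last x (m + l)"
      have v: "v \<in> carrier_vec n" and y: "y \<in> carrier_vec (m + l)" by (auto simp: v_def y_def)
      have xvy: "x = v @\<^sub>v y" using x by (simp add: v_def y_def)
      have PPc: "?PP \<in> carrier_mat (n + (m + l)) (n + (m + l))" using Atc Sc by simp
      \<comment> \<open>The eigenvalue equation tested with an arbitrary pair \<open>(w, z)\<close>;
        taking \<open>z = 0\<close> or \<open>w = 0\<close> recovers the two block equations
        separately.\<close>
      have weak: "bilin w (A h) v + bilin y D w + bilin z D v = r * (bilin w (At h) v + bilin z S y)"
        if w: "w \<in> carrier_vec n" and z: "z \<in> carrier_vec (m + l)" for w z :: "real Matrix.vec"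
      proof -
        have wz: "w @\<^sub>v z \<in> carrier_vec (n + (m + l))" using w z by simp
        have "bilin (w @\<^sub>v z) (saddle_mat (A h) (B h) (C h)) x = r * bilin (w @\<^sub>v z) ?PP x"
          unfolding bilin_def eq
          by (rule scalar_prod_smult_distrib[OF wz mult_mat_vec_carrier[OF PPc x]])
        then show ?thesis
          unfolding xvy bilin_saddle_mat[OF Ac Bc Cc w z v y] spd_four_block_mat(2)[OF Ath S w z v y]
            D_def .
      qed
      have "r \<in> {- c .. - min \<delta> (g / 2)} \<union> {\<delta> .. c}"
        unfolding c_def
      proof (rule saddle_eigenpair_bounds[OF As Ath S Dc \<delta> \<Delta> \<kappa> g _ _ bounded infsup v y])
        show "\<delta> * bilin v (At h) v \<le> bilin v (A h) v" "bilin v (A h) v \<le> \<Delta> * bilin v (At h) v"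
          if "v \<in> carrier_vec n" for v :: "real Matrix.vec"
          using equiv[OF h, of v] that by (auto simp: n_def)
        show "v \<noteq> 0\<^sub>v n \<or> y \<noteq> 0\<^sub>v (m + l)" using nz unfolding xvy by auto
        show "bilin w (A h) v + bilin y D w = r * bilin w (At h) v" if "w \<in> carrier_vec n" for w :: "real Matrix.vec"
          using weak[OF that zero_carrier_vec] bilin_zero_left[OF Dc v] bilin_zero_left[OF Sc y] by simp
        show "bilin z D v = r * bilin z S y" if "z \<in> carrier_vec (m + l)" for z :: "real Matrix.vec"
          using weak[OF zero_carrier_vec that] bilin_zero_left[OF Ac v] bilin_zero_left[OF Atc v]
            bilin_zero_right[OF Dc y] by simp
      qed
      then show ?thesis unfolding \<rho> by blast
    qed
    then show ?thesis unfolding PP using spd_mat_invertible[OF PPs] by blast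
  qed
  show ?thesis
    unfolding Let_def using main c \<delta> g
    by (intro exI[of _ c] exI[of _ "min \<delta> (g / 2)"] exI[of _ \<delta>] conjI ballI) auto
qed

end
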